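(* Let $\hat p^\star$ be the natural distribution estimator described in the context. For any distribution $p$ over a finite or countably infinite alphabet $\mathcal X$, positive integer $n$, sample $X^n\sim p$ with profile $\Phi^n:=\varphi(X^n)$, and \[ \hat p^{\mathcal N}_{X^n}:=\operatorname*{arg\,min}_{\hat p\in\mathcal N}\ell_{\mathrm{KL}}(p,\hat p_{X^n}), \] we have, with probability at least $1-\mathcal O(1/n)$, \[ \ell_H(p,\hat p^\star_{X^n})-\ell_H(p,\hat p^{\mathcal N}_{X^n})\le\tilde{\mathcal O}\left(\sqrt{\frac{\lceil H(\Phi^n)\rceil}{n}}\right). \]
   Context: The multiplicity of a symbol in a sequence $x^n$ is the number of times it appears; the profile $\varphi(x^n)$ is the multiset of multiplicities of the symbols appearing in $x^n$; its dimension $\mathcal D(\varphi(x^n))$ is the number of distinct multiplicities. $X^n\sim p$ is an i.i.d. sample, $\Phi^n=\varphi(X^n)$, $H(\Phi^n)$ is the Shannon entropy of the random variable $\Phi^n$, and $\mathcal D_n:=\mathcal D(\Phi^n)$. $\lceil x\rceil$ is the smallest integer larger than $x$. A distribution estimator $\hat p$ associates with every sequence $x^n$ over $\mathcal X$ a distribution $\hat p_{x^n}$ over $\mathcal X$; it is natural if it assigns the same probability to symbols of equal multiplicity in $x^n$. $\mathcal N$ is the collection of all natural estimators. $\ell_{\mathrm{KL}}(p,q)=\sum_x p_x\log(p_x/q_x)$ is the KL divergence, and $\ell_H(p,q):=|H(p)-H(q)|$ where $H$ is Shannon entropy. The minimization defining $\hat p^{\mathcal N}_{X^n}$ is instance-wise: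 it uses knowledge of $p$ and of the realized sample. The estimator $\hat p^\star$ is a natural distribution estimator (from earlier work of Hao and Orlitsky) with the following properties: (i) for every $p$ and $X^n\sim p$, with probability at least $1-\mathcal O(1/n)$, $\ell_{\mathrm{KL}}(p,\hat p^\star_{X^n})-\min_{\hat p\in\mathcal N}\ell_{\mathrm{KL}}(p,\hat p_{X^n})\le\tilde{\mathcal O}(\mathcal D_n/n)$; (ii) the smallest nonzero probability of $\hat p^\star_{X^n}$ is at least $1/n^4$. $\mathcal O$ hides absolute constants and $\tilde{\mathcal O}$ additionally hides powers of $\log n$ (factors of the form $C(1+\log n)^{C}$).
   Formalization: Property (i) and the conclusion are asserted only on samples where the minimal KL loss over natural estimators is finite. This is automatic for finite alphabets; over infinite ones with unseen mass every natural estimator has infinite loss, so the arg min and excess loss are undefined. *)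

theory Defs
  imports "HOL-Probability.Probability"
begin

definition profile :: "'a list \<Rightarrow> nat multiset" where
  "profile xs = image_mset (count_list xs) (mset_set (set xs))"

definition dimension :: "nat multiset \<Rightarrow> nat" where
  "dimension \<phi> = card (set_mset \<phi>)"

definition profile_pmf :: "nat \<Rightarrow> 'a pmf \<Rightarrow> nat multiset pmf" where
  "profile_pmf n p = map_pmf profile (replicate_pmf n p)"

(* Natural logarithms throughout. The entropy of a distribution with infinite support may be
   infinite; the summands are nonnegative, and 0 * ln (1 / 0) = 0. *)
definition shannon_entropy :: "'a pmf \<Rightarrow> ereal" where
  "shannon_entropy p = enn2ereal (\<integral>\<^sup>+x. ennreal (pmf p x * ln (1 / pmf p x)) \<partial>count_space UNIV)"

(* The negative parts of the summands always have a finite sum, so a series that is not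
   summable has value infinity. *)
definition kl_loss :: "'a pmf \<Rightarrow> 'a pmf \<Rightarrow> ereal" where
  "kl_loss p q =
     (if set_pmf p \<subseteq> set_pmf q \<and> (\<lambda>x. pmf p x * ln (pmf p x / pmf q x)) summable_on set_pmf p
      then ereal (\<Sum>\<^sub>\<infinity>x\<in>set_pmf p. pmf p x * ln (pmf p x / pmf q x))
      else \<infinity>)"

definition entropy_loss :: "'a pmf \<Rightarrow> 'a pmf \<Rightarrow> ereal" where
  "entropy_loss p q = \<bar>shannon_entropy p - shannon_entropy q\<bar>"

definition samples :: "'a set \<Rightarrow> nat \<Rightarrow> 'a list set" where
  "samples X n = {xs. set xs \<subseteq> X \<and> length xs = n}"

(* Distributions over the alphabet X are the pmfs supported in X. Values of an estimator outside
   the samples of length n are irrelevant. Symbols of X not occurring in the sample all have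
   multiplicity 0, hence receive equal probability; if X is infinite, this probability is 0. *)
definition natural_estimators :: "'a set \<Rightarrow> nat \<Rightarrow> ('a list \<Rightarrow> 'a pmf) set" where
  "natural_estimators X n =
     {q. \<forall>xs\<in>samples X n. set_pmf (q xs) \<subseteq> X \<and>
           (\<forall>x\<in>X. \<forall>y\<in>X. count_list xs x = count_list xs y \<longrightarrow> pmf (q xs) x = pmf (q xs) y)}"

definition best_natural_estimator :: "'a set \<Rightarrow> nat \<Rightarrow> 'a pmf \<Rightarrow> ('a list \<Rightarrow> 'a pmf) \<Rightarrow> bool" where
  "best_natural_estimator X n p q \<longleftrightarrow>
     (\<forall>xs\<in>samples X n. is_arg_min (\<lambda>e. kl_loss p (e xs)) (\<lambda>e. e \<in> natural_estimators X n) q)"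

definition best_natural_kl :: "'a set \<Rightarrow> nat \<Rightarrow> 'a pmf \<Rightarrow> 'a list \<Rightarrow> ereal" where
  "best_natural_kl X n p xs = (INF e\<in>natural_estimators X n. kl_loss p (e xs))"

(* One constant c serves both for the failure probability c / n and for the factor
   c * (1 + ln n) powr c hidden in the soft O. The excess loss is meaningful only when the best
   natural loss is finite (otherwise it is infinity - infinity), so nothing is required of the
   estimator elsewhere. The best natural loss is always finite over a finite alphabet; over an
   infinite one it is finite exactly when every symbol of the support of p has been observed. *)
definition competitive_estimator :: "real \<Rightarrow> 'a set \<Rightarrow> nat \<Rightarrow> ('a list \<Rightarrow> 'a pmf) \<Rightarrow> bool" where
  "competitive_estimator c X n q \<longleftrightarrow>
     q \<in> natural_estimators X n \<and>
     (\<forall>p. set_pmf p \<subseteq> X \<longrightarrow>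
        measure_pmf.prob (replicate_pmf n p)
          {xs. best_natural_kl X n p xs < \<infinity> \<longrightarrow>
               kl_loss p (q xs) - best_natural_kl X n p xs
                 \<le> ereal (c * (1 + ln (real n)) powr c * (real (dimension (profile xs)) / real n))}
        \<ge> 1 - c / real n) \<and>
     (\<forall>xs\<in>samples X n. \<forall>x\<in>set_pmf (q xs). pmf (q xs) x \<ge> 1 / real n ^ 4)"

(* The smallest integer strictly larger than x; in particular it is 1 at x = 0. *)
definition strict_ceiling :: "real \<Rightarrow> int" where
  "strict_ceiling x = \<lfloor>x\<rfloor> + 1"

(* A profile of a sample of length n takes finitely many values, so this entropy is finite. *)
definition profile_entropy :: "nat \<Rightarrow> 'a pmf \<Rightarrow> real" where
  "profile_entropy n p = real_of_ereal (shannon_entropy (profile_pmf n p))"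

(* Over a finite alphabet the loss of the best natural estimator is finite. *)
lemma best_natural_estimator_finite_loss:
  assumes X: "finite X" "set_pmf p \<subseteq> X"
    and q: "best_natural_estimator X n p q" and xs: "xs \<in> samples X n"
  shows "kl_loss p (q xs) < \<infinity>"
proof -
  have ne: "X \<noteq> {}"
    using X(2) set_pmf_not_empty[of p] by auto
  let ?u = "\<lambda>xs :: 'a list. pmf_of_set X"
  have "?u \<in> natural_estimators X n"
    using X(1) ne by (auto simp: natural_estimators_def)
  then have "\<not> kl_loss p (?u xs) < kl_loss p (q xs)"
    using q xs unfolding best_natural_estimator_def is_arg_min_def by blast
  moreover have "finite (set_pmf p)"
    using X finite_subset by blast
  then have "kl_loss p (?u xs) < \<infinity>"
    using X ne by (simp add: kl_loss_def)
  ultimately show ?thesis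
    by (metis linorder_not_less order_le_less_trans)
qed

end

theory Submission
  imports Defs
begin

text \<open>
  Let \<open>D\<close> be the dimension of the profile of the sample. The best natural estimator averages
  \<open>p\<close> over the classes of symbols of equal multiplicity, and for natural \<open>q\<close> the Pythagorean
  identity turns the excess KL loss into the divergence of \<open>q\<close> from this average. Hence it is
  \<open>O(D / n)\<close> up to logarithms, and by a Pinsker-type inequality and the lower bound \<open>1 / n\<^sup>4\<close> on the
  probabilities of \<open>q\<close>, the two entropies differ by at most \<open>O(sqrt (D / n))\<close> up to logarithms.

  It remains to bound \<open>D\<close> by the entropy of the profile. Place symbol \<open>x\<close> at \<open>sqrt (n p(x))\<close>; with
  high probability all values \<open>sqrt N(x)\<close> lie within \<open>R = O(1 + ln n)\<close> of these points, so a unit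
  interval at distance \<open>j\<close> from 0 contributes at most the smaller of \<open>O(R j)\<close> and its number of
  symbols to \<open>D\<close>. Choose from each such interval at most \<open>j / 500\<close> symbols to get a set \<open>S\<close> with
  \<open>D \<le> O(R\<^sup>2 + R |S|)\<close>. Given all sample positions whose symbol is outside \<open>S\<close>, the counts in \<open>S\<close>
  are multinomial, hence dominated by \<open>e n\<close> times independent Poisson laws. For each \<open>k\<close>, the
  expected number of symbols of \<open>S\<close> with Poisson count \<open>k\<close> is at most 1/2 by the sparsity of \<open>S\<close>, and bounding a
  permanent by its column sums shows that every profile has conditional probability at most
  \<open>e n / 2 ^ |S|\<close>. So \<open>|S|\<close> is \<open>O(H + 1 + ln n)\<close>, where \<open>H\<close> is the entropy of the profile.
\<close>

section \<open>Poisson weights and binomial counts\<close>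

text \<open>Kept as a plain real function rather than as \<open>poisson_pmf\<close>, so that the
  rate may be 0, as happens for symbols of probability 0.\<close>

definition poisson_weight :: "real \<Rightarrow> nat \<Rightarrow> real" where
  "poisson_weight l k = exp (- l) * l ^ k / fact k"

lemma poisson_weight_nonneg: "l \<ge> 0 \<Longrightarrow> poisson_weight l k \<ge> 0"
  by (simp add: poisson_weight_def)

lemma poisson_weight_sum_le_1:
  assumes "l > 0" "finite A"
  shows "(\<Sum>k\<in>A. poisson_weight l k) \<le> 1"
proof -
  have "(\<Sum>k\<in>A. poisson_weight l k) = measure_pmf.prob (poisson_pmf l) A"
    using assms by (simp add: measure_measure_pmf_finite poisson_weight_def mult.commute)
  then show ?thesis by simp
qed

lemma poisson_weight_le_1: "l \<ge> 0 \<Longrightarrow> poisson_weight l k \<le> 1"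
proof (cases "l = 0")
  case True
  then show ?thesis by (cases k) (simp_all add: poisson_weight_def)
next
  case False
  assume "l \<ge> 0"
  then show ?thesis using poisson_weight_sum_le_1[of l "{k}"] False by simp
qed

lemma one_minus_le_ln:
  fixes x :: real assumes "x > 0" shows "1 - 1 / x \<le> ln x"
  using ln_le_minus_one[of "1/x"] assms by (simp add: ln_div)

text \<open>A crude form of Stirling's formula; the induction step amounts to
  \<open>(1 + 1 / n) ^ (n + 1) \<ge> exp 1\<close>. It fixes the price \<open>exp 1 * n\<close> of
  replacing binomial and multinomial laws by Poisson weights.\<close>

lemma fact_le_exp: 
  assumes "n \<ge> 1"
  shows "fact n \<le> exp 1 * real n * (real n ^ n * exp (- real n))"
  using assms
proof (induction n rule: dec_induct)
  case base
  then show ?case by (simp add: exp_minus)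
next
  case (step n)
  have n: "real n > 0" using step by simp
  have "1 \<le> real (Suc n) * ln (real (Suc n) / real n)"
  proof -
    have "1 - 1 / (real (Suc n) / real n) \<le> ln (real (Suc n) / real n)"
      using n by (intro one_minus_le_ln) simp
    moreover have "1 - 1 / (real (Suc n) / real n) = 1 / real (Suc n)"
      using n by (simp add: field_simps)
    ultimately show ?thesis
      by (simp add: field_simps)
  qed
  then have "exp 1 \<le> exp (real (Suc n) * ln (real (Suc n) / real n))"
    by simp
  also have "\<dots> = (real (Suc n) / real n) ^ Suc n"
    using n by (subst exp_of_nat_mult) simp
  finally have e: "real n ^ Suc n \<le> real (Suc n) ^ Suc n * exp (-1)"
    using n by (simp add: power_divide field_simps exp_minus)
  have "fact (Suc n) = real (Suc n) * fact n" by simp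
  also have "\<dots> \<le> real (Suc n) * (exp 1 * real n * (real n ^ n * exp (- real n)))"
    by (rule mult_left_mono[OF step.IH]) simp
  also have "\<dots> = real (Suc n) * exp 1 * exp (- real n) * real n ^ Suc n"
    by (simp add: field_simps)
  also have "\<dots> \<le> real (Suc n) * exp 1 * exp (- real n) * (real (Suc n) ^ Suc n * exp (-1))"
    by (rule mult_left_mono[OF e]) simp
  also have "\<dots> = exp 1 * real (Suc n) * (real (Suc n) ^ Suc n * exp (- real (Suc n)))"
  proof -
    have "exp (- real (Suc n)) = exp (- real n) * exp (-1)"
      by (simp add: exp_add[symmetric])
    then show ?thesis by (simp only: mult_ac)
  qed
  finally show ?case .
qed

text \<open>Square roots stabilise the variance of Poisson laws, so deviations are measured on that
  scale. With \<open>t = sqrt l\<close> and \<open>s = sqrt k\<close>, applying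
  \<open>ln u \<le> u - 1\<close> to \<open>u = t / s\<close> instead of \<open>l / k\<close>
  completes the square.\<close>

lemma poisson_weight_le_diag:
  assumes "l \<ge> 0"
  shows "poisson_weight l k \<le> poisson_weight (real k) k * exp (- (sqrt l - sqrt (real k))\<^sup>2)"
proof (cases "k = 0 \<or> l = 0")
  case True
  then show ?thesis
  proof
    assume "k = 0" then show ?thesis using assms by (simp add: poisson_weight_def)
  next
    assume "l = 0" then show ?thesis
      by (cases "k = 0") (simp_all add: poisson_weight_def zero_power)
  qed
next
  case False
  then have k: "real k > 0" and l: "l > 0" using assms by auto
  define s t where "s = sqrt (real k)" and "t = sqrt l"
  have st: "s > 0" "t > 0" "real k = s\<^sup>2" "l = t\<^sup>2"
    using k l by (auto simp: s_def t_def)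
  have "real k * ln (l / real k) = 2 * s\<^sup>2 * ln (t / s)"
    using st by (simp add: ln_div ln_realpow)
  also have "\<dots> \<le> 2 * s\<^sup>2 * (t / s - 1)"
    using st by (intro mult_left_mono ln_le_minus_one) auto
  also have "\<dots> = 2 * s * t - 2 * s\<^sup>2"
    using st by (simp add: field_simps power2_eq_square)
  finally have "- l + real k * ln (l / real k) \<le> - real k - (t - s)\<^sup>2"
    using st by (simp add: power2_eq_square algebra_simps)
  then have "exp (- l + real k * ln (l / real k)) \<le> exp (- real k - (t - s)\<^sup>2)" by simp
  moreover have "exp (- l + real k * ln (l / real k)) = exp (-l) * (l / real k) ^ k"
    using k l by (subst exp_add, subst exp_of_nat_mult) (simp del: ln_div)
  moreover have "exp (- real k - (t - s)\<^sup>2) = exp (- real k) * exp (- (t - s)\<^sup>2)"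
    by (simp add: exp_diff exp_minus field_simps)
  ultimately have "exp (-l) * (l / real k) ^ k \<le> exp (- real k) * exp (- (t - s)\<^sup>2)" by simp
  then have "exp (-l) * l ^ k \<le> exp (- real k) * real k ^ k * exp (- (t - s)\<^sup>2)"
    using k by (simp add: power_divide field_simps)
  then show ?thesis
    by (simp add: poisson_weight_def s_def t_def divide_right_mono)
qed

lemma poisson_weight_le_exp:
  assumes "l \<ge> 0"
  shows "poisson_weight l k \<le> exp (- (sqrt l - sqrt (real k))\<^sup>2)"
proof -
  note poisson_weight_le_diag[OF assms, of k]
  also have "poisson_weight (real k) k * exp (- (sqrt l - sqrt (real k))\<^sup>2)
      \<le> 1 * exp (- (sqrt l - sqrt (real k))\<^sup>2)"
    by (intro mult_right_mono poisson_weight_le_1) auto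
  finally show ?thesis by simp
qed

(* The weights at k, ..., k + i with i = floor (sqrt k) are comparable, and their sum is at most 1. *)
lemma poisson_weight_diag_le:
  assumes "k \<ge> 1"
  shows "poisson_weight (real k) k \<le> exp 1 / sqrt (real k)"
proof -
  define m where "m = nat \<lfloor>sqrt (real k)\<rfloor>"
  have k: "real k > 0" using assms by simp
  have m: "real m \<le> sqrt (real k)" "sqrt (real k) < real m + 1"
    by (auto simp: m_def)
  have m2: "real m * real m \<le> real k"
    using m(1) mult_mono[OF m(1) m(1)] by simp
  \<comment> \<open>The quotient of successive weights is
    \<open>k / (k + i + 1) \<ge> exp (- (i + 1) / k)\<close>, and the numerators
    \<open>1, ..., i\<close> add up to at most \<open>i * i\<close>.\<close>
  have le: "poisson_weight (real k) k * exp (- real (i * i) / real k) \<le> poisson_weight (real k) (k + i)" for i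
  proof (induction i)
    case (Suc i)
    have "exp (- real (Suc i * Suc i) / real k) \<le> exp (- real (i * i) / real k) * exp (- real (Suc i) / real k)"
      using k by (simp add: exp_add[symmetric] divide_simps)
    also have "exp (- real (Suc i) / real k) \<le> real k / real (k + Suc i)"
    proof -
      have "1 + real (Suc i) / real k \<le> exp (real (Suc i) / real k)"
        by (rule exp_ge_add_one_self)
      then have "1 / exp (real (Suc i) / real k) \<le> 1 / (1 + real (Suc i) / real k)"
        by (intro divide_left_mono) (auto intro!: add_pos_nonneg mult_pos_pos)
      also have "\<dots> = real k / real (k + Suc i)"
        using k by (simp add: field_simps)
      finally show ?thesis by (simp add: exp_minus inverse_eq_divide minus_divide_left[symmetric] del: of_nat_Suc)
    qed
    finally have "poisson_weight (real k) k * exp (- real (Suc i * Suc i) / real k)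
       \<le> poisson_weight (real k) k * (exp (- real (i * i) / real k) * (real k / real (k + Suc i)))"
      by (intro mult_left_mono) (auto simp: poisson_weight_nonneg)
    also have "\<dots> \<le> poisson_weight (real k) (k + i) * (real k / real (k + Suc i))"
      unfolding mult.assoc[symmetric] by (intro mult_right_mono Suc) auto
    also have "\<dots> = poisson_weight (real k) (k + Suc i)"
      by (simp add: poisson_weight_def divide_simps)
    finally show ?case .
  qed simp
  have "sqrt (real k) * (poisson_weight (real k) k * exp (-1))
      \<le> real (Suc m) * (poisson_weight (real k) k * exp (-1))"
    using m by (intro mult_right_mono) (auto simp: poisson_weight_nonneg)
  also have "\<dots> = (\<Sum>i\<le>m. poisson_weight (real k) k * exp (-1))" by simp
  also have "\<dots> \<le> (\<Sum>i\<le>m. poisson_weight (real k) (k + i))"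
  proof (rule sum_mono)
    fix i assume "i \<in> {..m}"
    then have "real (i * i) \<le> real (m * m)" by (simp add: mult_mono)
    then have "real (i * i) / real k \<le> 1" using m2 k by (simp add: field_simps)
    then have "poisson_weight (real k) k * exp (-1) \<le> poisson_weight (real k) k * exp (- real (i * i) / real k)"
      by (intro mult_left_mono) (auto simp: poisson_weight_nonneg)
    then show "poisson_weight (real k) k * exp (-1) \<le> poisson_weight (real k) (k + i)"
      using le[of i] by linarith
  qed
  also have "\<dots> = (\<Sum>j\<in>(+) k ` {..m}. poisson_weight (real k) j)"
    by (subst sum.reindex) (auto simp: inj_on_def)
  also have "\<dots> \<le> 1" using k by (intro poisson_weight_sum_le_1) auto
  finally show ?thesis using k by (simp add: exp_minus field_simps)
qed

lemma mult_exp_neg_sq_le_1: "u * exp (- u\<^sup>2) \<le> (1::real)"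
proof -
  have "u \<le> 1 + u\<^sup>2" using zero_le_power2[of "u - 1/2"] by (simp add: power2_eq_square algebra_simps)
  also have "\<dots> \<le> exp (u\<^sup>2)" by (rule exp_ge_add_one_self)
  finally show ?thesis by (simp add: exp_minus field_simps)
qed

text \<open>If \<open>sqrt k\<close> is at least half of \<open>sqrt l\<close>, the diagonal bound
  supplies the prefactor. Otherwise the deviation exceeds \<open>sqrt l / 2\<close>, and half of the
  Gaussian exponent pays for it. The decay of the prefactor in \<open>sqrt l\<close> is what later
  allows the number of chosen symbols per band to grow linearly.\<close>

lemma poisson_weight_le_gauss:
  assumes "l > 0"
  shows "poisson_weight l k \<le> 6 / sqrt l * exp (- (sqrt l - sqrt (real k))\<^sup>2 / 2)"
proof -
  define s t where "s = sqrt (real k)" and "t = sqrt l"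
  have st: "s \<ge> 0" "t > 0" using assms by (auto simp: s_def t_def)
  have e3: "exp 1 \<le> (3::real)" using exp_le by simp
  have half: "exp (- (t - s)\<^sup>2) = exp (- (t - s)\<^sup>2 / 2) * exp (- (t - s)\<^sup>2 / 2)"
    by (simp add: exp_add[symmetric])
  have A: "poisson_weight l k \<le> poisson_weight (real k) k * exp (- (t - s)\<^sup>2)"
    using poisson_weight_le_diag[of l k] assms by (simp add: s_def t_def)
  show ?thesis
  proof (cases "s \<ge> t / 2")
    case True
    then have "s > 0" using st by linarith
    then have "k \<ge> 1" by (cases k) (auto simp: s_def)
    then have "poisson_weight (real k) k \<le> exp 1 / s" unfolding s_def by (rule poisson_weight_diag_le)
    also have "\<dots> \<le> 3 / (t / 2)" using e3 True st by (intro frac_le) auto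
    finally have B: "poisson_weight (real k) k \<le> 6 / t" by simp
    have "poisson_weight l k \<le> 6 / t * exp (- (t - s)\<^sup>2)"
      using A mult_right_mono[OF B, of "exp (- (t - s)\<^sup>2)"] by simp
    also have "\<dots> \<le> 6 / t * exp (- (t - s)\<^sup>2 / 2)"
      using st by (intro mult_left_mono) auto
    finally show ?thesis by (simp add: s_def t_def)
  next
    case False
    have "poisson_weight l k \<le> exp (- (t - s)\<^sup>2)"
      using poisson_weight_le_exp[of l k] assms by (simp add: s_def t_def)
    also have "\<dots> \<le> 6 / t * exp (- (t - s)\<^sup>2 / 2)"
    proof -
      have "(t / 2)\<^sup>2 \<le> (t - s)\<^sup>2" using False st by (intro power_mono) auto
      then have "- (t - s)\<^sup>2 / 2 \<le> - (t / 4)\<^sup>2"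
      proof -
        have "(t / 4)\<^sup>2 = t\<^sup>2 / 16" "(t / 2)\<^sup>2 = t\<^sup>2 / 4" "0 \<le> t\<^sup>2"
          by (simp_all add: power_divide)
        then show ?thesis using \<open>(t / 2)\<^sup>2 \<le> (t - s)\<^sup>2\<close> by linarith
      qed
      then have "exp (- (t - s)\<^sup>2 / 2) \<le> exp (- (t / 4)\<^sup>2)" by simp
      also have "\<dots> \<le> 6 / t" using mult_exp_neg_sq_le_1[of "t/4"] st by (simp add: field_simps)
      finally show ?thesis unfolding half by (intro mult_right_mono) auto
    qed
    finally show ?thesis by (simp add: s_def t_def)
  qed
qed

section \<open>Counts in an i.i.d. sample\<close>

lemma measure_pmf_bind_expectation:
  "measure_pmf.prob (bind_pmf N K) A = (\<integral>x. measure_pmf.prob (K x) A \<partial>measure_pmf N)"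
proof -
  have "pmf (bind_pmf N (\<lambda>x. map_pmf (\<lambda>y. y \<in> A) (K x))) True
      = (\<integral>x. pmf (map_pmf (\<lambda>y. y \<in> A) (K x)) True \<partial>measure_pmf N)"
    by (rule pmf_bind)
  moreover have "pmf (map_pmf (\<lambda>y. y \<in> A) q) True = measure_pmf.prob q A" for q :: "'a pmf"
    by (simp add: pmf_map vimage_def)
  ultimately show ?thesis
    by (simp add: map_bind_pmf[symmetric])
qed

lemma prob_pmf_Compl: "measure_pmf.prob p (- A) = 1 - measure_pmf.prob p A"
  using measure_pmf.prob_compl[of A p] by (simp add: Compl_eq_Diff_UNIV)

lemma prob_replicate_Suc:
  "measure_pmf.prob (replicate_pmf (Suc n) p) A
     = (\<integral>x. measure_pmf.prob (replicate_pmf n p) {xs. x # xs \<in> A} \<partial>measure_pmf p)"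
proof -
  have "replicate_pmf (Suc n) p = bind_pmf p (\<lambda>x. map_pmf ((#) x) (replicate_pmf n p))"
    by (simp add: map_pmf_def)
  then have "measure_pmf.prob (replicate_pmf (Suc n) p) A
     = (\<integral>x. measure_pmf.prob (map_pmf ((#) x) (replicate_pmf n p)) A \<partial>measure_pmf p)"
    by (simp only: measure_pmf_bind_expectation)
  then show ?thesis by (simp add: measure_map_pmf vimage_def)
qed

lemma prob_length_filter:
  "measure_pmf.prob (replicate_pmf n p) {xs. length (filter Q xs) = k}
     = real (n choose k) * measure_pmf.prob p {x. Q x} ^ k * (1 - measure_pmf.prob p {x. Q x}) ^ (n - k)"
proof (induction n arbitrary: k)
  case 0
  show ?case by (cases k) (auto simp: measure_return)
next
  case (Suc n)
  define q where "q = measure_pmf.prob p {x. Q x}"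
  define F where "F k = measure_pmf.prob (replicate_pmf n p) {xs. length (filter Q xs) = k}" for k
  \<comment> \<open>Probability of \<open>k - 1\<close> hits in the tail, with value 0 at
    \<open>k = 0\<close>: a hit in first position then leaves no way to reach \<open>k\<close>. The
    recursion below is Pascal's rule.\<close>
  define G where "G = (case k of 0 \<Rightarrow> 0 | Suc j \<Rightarrow> F j)"
  have "measure_pmf.prob (replicate_pmf n p) {xs. x # xs \<in> {xs. length (filter Q xs) = k}}
      = G * indicator {x. Q x} x + F k * (1 - indicator {x. Q x} x)" for x
    by (cases k) (auto simp: F_def G_def indicator_def)
  then have "measure_pmf.prob (replicate_pmf (Suc n) p) {xs. length (filter Q xs) = k}
     = (\<integral>x. G * indicator {x. Q x} x + F k * (1 - indicator {x. Q x} x) \<partial>measure_pmf p)"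
    by (simp only: prob_replicate_Suc)
  also have "\<dots> = G * q + F k * (1 - q)"
  proof -
    have "(\<lambda>x. G * indicator {x. Q x} x + F k * (1 - indicator {x. Q x} x))
        = (\<lambda>x. F k + (G - F k) * indicat_real {x. Q x} x)"
      by (auto simp: indicator_def)
    moreover have "integrable (measure_pmf p) (indicat_real {x. Q x})"
      by (intro measure_pmf.integrable_const_bound[where B = 1]) (auto simp: indicator_def)
    ultimately show ?thesis
      by (simp add: q_def algebra_simps)
  qed
  also have "\<dots> = real (Suc n choose k) * q ^ k * (1 - q) ^ (Suc n - k)"
  proof (cases k)
    case 0
    then show ?thesis using Suc[of 0] by (simp add: G_def F_def q_def)
  next
    case (Suc j)
    show ?thesis
    proof (cases "k \<le> n")
      case True
      then have "Suc n - k = Suc (n - k)" "n - j = Suc (n - k)" using Suc by auto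
      then show ?thesis using Suc
        by (simp add: G_def F_def Suc.IH q_def[symmetric] algebra_simps)
    next
      case False
      then show ?thesis using Suc
        by (cases "j = n") (simp_all add: G_def F_def Suc.IH q_def[symmetric] binomial_eq_0 not_le)
    qed
  qed
  finally show ?case by (simp add: q_def)
qed

text \<open>The binomial probability is the product of the Poisson weights of hits and misses,
  divided by the weight of rate \<open>n\<close> at \<open>n\<close>. The reciprocal of the latter
  is at most \<open>exp 1 * n\<close> by \<open>fact_le_exp\<close>, and the weight of the misses is
  at most 1.\<close>

lemma prob_length_filter_le_poisson:
  assumes "n \<ge> 1"
  shows "measure_pmf.prob (replicate_pmf n p) {xs. length (filter Q xs) = k}
     \<le> exp 1 * real n * poisson_weight (real n * measure_pmf.prob p {x. Q x}) k"
proof (cases "k \<le> n")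
  case False
  then show ?thesis using assms
    by (simp add: prob_length_filter binomial_eq_0 poisson_weight_nonneg)
next
  case True
  define q where "q = measure_pmf.prob p {x. Q x}"
  have q: "0 \<le> q" "q \<le> 1" by (auto simp: q_def)
  have n: "real n > 0" using assms by simp
  have "real (n choose k) * q ^ k * (1 - q) ^ (n - k)
      = (fact n / (real n ^ n * exp (- real n))) * poisson_weight (real n * q) k
         * poisson_weight (real n * (1 - q)) (n - k)"
  proof -
    have "real n ^ n = real n ^ k * real n ^ (n - k)" using True by (simp flip: power_add)
    moreover have "exp (- real n) = exp (- (real n * q)) * exp (- (real n * (1 - q)))"
      by (simp add: exp_add[symmetric] algebra_simps)
    ultimately show ?thesis using n True
      by (simp add: poisson_weight_def binomial_fact power_mult_distrib)
  qed
  also have "\<dots> \<le> (exp 1 * real n) * poisson_weight (real n * q) k * 1"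
  proof (intro mult_mono)
    show "fact n / (real n ^ n * exp (- real n)) \<le> exp 1 * real n"
      using fact_le_exp[OF assms] n by (simp add: pos_divide_le_eq)
  qed (use q in \<open>auto intro!: poisson_weight_le_1 mult_nonneg_nonneg poisson_weight_nonneg\<close>)
  finally show ?thesis by (simp add: prob_length_filter q_def)
qed

section \<open>Atoms of the profile of a multinomial sample\<close>

lemma prob_counts_multinomial:
  assumes "finite S" "set_pmf q \<subseteq> S" "(\<Sum>x\<in>S. f x) = M"
  shows "measure_pmf.prob (replicate_pmf M q) {xs. \<forall>x\<in>S. count_list xs x = f x}
     = fact M * (\<Prod>x\<in>S. pmf q x ^ f x / fact (f x))"
  using assms(3)
proof (induction M arbitrary: f)
  case 0
  then have "\<forall>x\<in>S. f x = 0" using assms(1) by simp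
  then show ?case by (simp add: measure_return)
next
  case (Suc M)
  define W where "W = (\<Prod>x\<in>S. pmf q x ^ f x / fact (f x))"
  \<comment> \<open>A first symbol \<open>y\<close> lowers the count still required of
    \<open>y\<close> by one. The missing power and the smaller factorial together yield the factor
    \<open>f y\<close>; over all \<open>y\<close> these factors sum to \<open>Suc M\<close>.\<close>
  have step: "measure_pmf.prob (replicate_pmf M q) {xs. \<forall>x\<in>S. count_list (y # xs) x = f x} * pmf q y
      = real (f y) * (fact M * W)" if y: "y \<in> S" for y
  proof (cases "f y")
    case 0
    then have "{xs. \<forall>x\<in>S. count_list (y # xs) x = f x} = {}" using y by auto
    then show ?thesis using 0 by (simp only: measure_empty)
  next
    case (Suc m)
    define g where "g = f(y := m)"
    have eq: "{xs. \<forall>x\<in>S. count_list (y # xs) x = f x} = {xs. \<forall>x\<in>S. count_list xs x = g x}"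
      using Suc y by (auto simp: g_def)
    have rest: "(\<Prod>x\<in>S - {y}. pmf q x ^ g x / fact (g x)) = (\<Prod>x\<in>S - {y}. pmf q x ^ f x / fact (f x))"
      by (intro prod.cong) (auto simp: g_def)
    have "(\<Sum>x\<in>S. f x) = f y + (\<Sum>x\<in>S - {y}. f x)" "(\<Sum>x\<in>S. g x) = g y + (\<Sum>x\<in>S - {y}. g x)"
      using y assms(1) by (auto intro: sum.remove)
    moreover have "(\<Sum>x\<in>S - {y}. g x) = (\<Sum>x\<in>S - {y}. f x)"
      by (intro sum.cong) (auto simp: g_def)
    ultimately have "(\<Sum>x\<in>S. g x) = M" using Suc.prems Suc by (simp add: g_def)
    then have "measure_pmf.prob (replicate_pmf M q) {xs. \<forall>x\<in>S. count_list xs x = g x}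
        = fact M * (\<Prod>x\<in>S. pmf q x ^ g x / fact (g x))"
      by (rule Suc.IH)
    moreover have "(\<Prod>x\<in>S. pmf q x ^ g x / fact (g x)) * pmf q y = real (f y) * W"
      unfolding W_def prod.remove[OF assms(1) y] rest
      using Suc by (simp add: g_def field_simps del: of_nat_Suc)
    ultimately show ?thesis unfolding eq by (simp add: mult_ac)
  qed
  have "measure_pmf.prob (replicate_pmf (Suc M) q) {xs. \<forall>x\<in>S. count_list xs x = f x}
     = (\<integral>y. measure_pmf.prob (replicate_pmf M q) {xs. \<forall>x\<in>S. count_list (y # xs) x = f x} \<partial>measure_pmf q)"
    by (subst prob_replicate_Suc) (simp only: mem_Collect_eq)
  also have "\<dots> = (\<Sum>y\<in>S. measure_pmf.prob (replicate_pmf M q) {xs. \<forall>x\<in>S. count_list (y # xs) x = f x} * pmf q y)"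
    using assms by (intro integral_measure_pmf_real) auto
  also have "\<dots> = (\<Sum>y\<in>S. real (f y) * (fact M * W))"
    by (intro sum.cong refl step)
  also have "\<dots> = real (Suc M) * (fact M * W)"
    by (simp only: sum_distrib_right[symmetric] of_nat_sum[symmetric] Suc.prems)
  also have "\<dots> = fact (Suc M) * W" by simp
  finally show ?case by (simp only: W_def)
qed

text \<open>Extensional functions, so that distinct members differ on \<open>S\<close> and a sum
  over them meets every vector of counts once; the explicit finite range gives finiteness.\<close>

definition assignments :: "'a set \<Rightarrow> nat multiset \<Rightarrow> ('a \<Rightarrow> nat) set" where
  "assignments S \<psi> = {f \<in> S \<rightarrow>\<^sub>E set_mset \<psi>. image_mset f (mset_set S) = \<psi>}"

lemma finite_assignments: "finite S \<Longrightarrow> finite (assignments S \<psi>)"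
  by (auto simp: assignments_def intro!: finite_PiE)

lemma prod_mset_mono_real:
  fixes g h :: "'b \<Rightarrow> real"
  assumes "\<And>x. 0 \<le> g x" "\<And>x. g x \<le> h x"
  shows "(\<Prod>x\<in>#M. g x) \<le> (\<Prod>x\<in>#M. h x)" "0 \<le> (\<Prod>x\<in>#M. g x)"
proof -
  show nn: "0 \<le> (\<Prod>x\<in>#M. g x)" for M by (induction M) (auto simp: assms)
  show "(\<Prod>x\<in>#M. g x) \<le> (\<Prod>x\<in>#M. h x)"
    by (induction M) (use assms nn in \<open>auto intro!: mult_mono order_trans[OF assms(1) assms(2)]\<close>)
qed

(* The left-hand side is a permanent, divided by the number of permutations fixing the columns;
   it is bounded by the product of the column sums. *)
lemma sum_assignments_le_prod_column_sums:
  fixes a :: "'a \<Rightarrow> nat \<Rightarrow> real"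
  assumes "finite S" and a: "\<And>x k. 0 \<le> a x k"
  shows "(\<Sum>f\<in>assignments S \<psi>. \<Prod>x\<in>S. a x (f x)) \<le> (\<Prod>k\<in>#\<psi>. \<Sum>x\<in>S. a x k)"
  using assms(1)
proof (induction \<psi> arbitrary: S)
  case empty
  then show ?case
  proof (cases "S = {}")
    case True
    have "card (assignments S {#}) \<le> card {\<lambda>x :: 'a. undefined :: nat}"
      by (intro card_mono) (auto simp: True assignments_def)
    then show ?thesis using True by simp
  next
    case False
    then have "assignments S {#} = {}" by (auto simp: assignments_def)
    then show ?thesis by simp
  qed
next
  case (add k \<psi>)
  let ?I = "SIGMA x:S. assignments (S - {x}) \<psi>"
  have fin: "finite ?I" using add.prems by (auto intro!: finite_assignments)
  \<comment> \<open>Expansion of the permanent along one column: remove a symbol \<open>x\<close> of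
    value \<open>k\<close>. An assignment with several such symbols is counted repeatedly, which
    only enlarges the bound because all terms are nonnegative.\<close>
  have "assignments S (add_mset k \<psi>) \<subseteq> (\<lambda>(x, f). f(x := k)) ` ?I"
  proof
    fix f assume f: "f \<in> assignments S (add_mset k \<psi>)"
    then have img: "image_mset f (mset_set S) = add_mset k \<psi>" by (simp add: assignments_def)
    then have "k \<in> set_mset (image_mset f (mset_set S))" by simp
    then obtain x where x: "x \<in> S" "f x = k" using add.prems by auto
    define g where "g = restrict f (S - {x})"
    have "image_mset f (mset_set S) = add_mset k (image_mset f (mset_set (S - {x})))"
      using x mset_set.remove[OF add.prems x(1)] by simp
    then have "image_mset f (mset_set (S - {x})) = \<psi>" using img by simp
    moreover have "image_mset g (mset_set (S - {x})) = image_mset f (mset_set (S - {x}))"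
      using add.prems by (intro image_mset_cong) (auto simp: g_def)
    ultimately have gi: "image_mset g (mset_set (S - {x})) = \<psi>" by simp
    then have "set_mset \<psi> = g ` (S - {x})" using add.prems by force
    then have "g \<in> assignments (S - {x}) \<psi>"
      unfolding assignments_def using gi by (auto simp: g_def)
    moreover have "f = g(x := k)"
      using f x by (auto simp: g_def assignments_def PiE_def extensional_def fun_eq_iff)
    ultimately show "f \<in> (\<lambda>(x, f). f(x := k)) ` ?I"
      using x(1) by (intro image_eqI[where x = "(x, g)"]) auto
  qed
  then have "(\<Sum>f\<in>assignments S (add_mset k \<psi>). \<Prod>x\<in>S. a x (f x))
      \<le> (\<Sum>f\<in>(\<lambda>(x, f). f(x := k)) ` ?I. \<Prod>x\<in>S. a x (f x))"
    using fin a by (intro sum_mono2) (auto intro!: prod_nonneg)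
  also have "\<dots> \<le> (\<Sum>xf\<in>?I. \<Prod>y\<in>S. a y ((\<lambda>(x, f). f(x := k)) xf y))"
    using fin a by (intro order_trans[OF sum_image_le]) (auto intro!: prod_nonneg simp: o_def)
  also have "\<dots> = (\<Sum>x\<in>S. \<Sum>f\<in>assignments (S - {x}) \<psi>. \<Prod>y\<in>S. a y ((f(x := k)) y))"
    using add.prems by (subst sum.Sigma) (auto intro!: finite_assignments sum.cong)
  also have "\<dots> = (\<Sum>x\<in>S. a x k * (\<Sum>f\<in>assignments (S - {x}) \<psi>. \<Prod>y\<in>S - {x}. a y (f y)))"
    unfolding sum_distrib_left
    by (intro sum.cong refl, subst prod.remove[OF add.prems]) (auto intro!: prod.cong)
  also have "\<dots> \<le> (\<Sum>x\<in>S. a x k * (\<Prod>j\<in>#\<psi>. \<Sum>y\<in>S. a y j))"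
  proof (intro sum_mono mult_left_mono a)
    fix x assume "x \<in> S"
    have "(\<Sum>f\<in>assignments (S - {x}) \<psi>. \<Prod>y\<in>S - {x}. a y (f y)) \<le> (\<Prod>j\<in>#\<psi>. \<Sum>y\<in>S - {x}. a y j)"
      using add.prems by (intro add.IH) auto
    also have "\<dots> \<le> (\<Prod>j\<in>#\<psi>. \<Sum>y\<in>S. a y j)"
      using add.prems a by (intro prod_mset_mono_real sum_nonneg sum_mono2) auto
    finally show "(\<Sum>f\<in>assignments (S - {x}) \<psi>. \<Prod>y\<in>S - {x}. a y (f y)) \<le> (\<Prod>j\<in>#\<psi>. \<Sum>y\<in>S. a y j)" .
  qed
  finally show ?case by (simp add: sum_distrib_right)
qed

text \<open>A profile records only symbols that occur; the absent ones must be added as zeros before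
  it can be compared with the counts on all of \<open>S\<close>.\<close>

lemma image_mset_count_list_mset_set:
  assumes "finite S" "set xs \<subseteq> S"
  shows "image_mset (count_list xs) (mset_set S) = profile xs + replicate_mset (card S - size (profile xs)) 0"
proof -
  have S: "S = set xs \<union> (S - set xs)" using assms by auto
  have "mset_set S = mset_set (set xs) + mset_set (S - set xs)"
    using assms by (subst S, intro mset_set_Union) auto
  moreover have "image_mset (count_list xs) (mset_set (S - set xs)) = image_mset (\<lambda>_. 0) (mset_set (S - set xs))"
    using assms(1) by (intro image_mset_cong) auto
  moreover have "card (S - set xs) = card S - size (profile xs)"
    using assms by (simp add: profile_def card_Diff_subset)
  ultimately show ?thesis using assms
    by (simp add: profile_def image_mset_const_eq)
qed

text \<open>Union bound over the count vectors with the given profile. Each multinomial probability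
  is at most \<open>exp 1 * M\<close> times a product of Poisson weights; the permanent bound
  controls the sum of these products, with one column for each of the \<open>card S\<close> entries
  and a factor of at most \<open>1 / 2\<close> per column.\<close>

lemma pmf_profile_le:
  assumes "finite S" "set_pmf q \<subseteq> S" "M \<ge> 1"
    and load: "\<And>k. (\<Sum>x\<in>S. poisson_weight (real M * pmf q x) k) \<le> 1 / 2"
  shows "pmf (profile_pmf M q) \<psi> \<le> exp 1 * real M * (1 / 2) ^ card S"
proof -
  define \<psi>' where "\<psi>' = \<psi> + replicate_mset (card S - size \<psi>) 0"
  define A where "A = {f \<in> assignments S \<psi>'. (\<Sum>x\<in>S. f x) = M}"
  define E where "E f = {xs. \<forall>x\<in>S. count_list xs x = f x}" for f :: "'a \<Rightarrow> nat"
  let ?P = "measure_pmf.prob (replicate_pmf M q)"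
  have finA: "finite A" unfolding A_def using finite_assignments[OF assms(1)] by simp
  have M: "real M > 0" using assms by simp
  have sub: "{xs. profile xs = \<psi>} \<inter> set_pmf (replicate_pmf M q) \<subseteq> (\<Union>f\<in>A. E f)"
  proof
    fix xs assume "xs \<in> {xs. profile xs = \<psi>} \<inter> set_pmf (replicate_pmf M q)"
    then have xs: "profile xs = \<psi>" "length xs = M" "set xs \<subseteq> S"
      using assms(2) by (auto simp: set_replicate_pmf in_lists_conv_set)
    define f where "f = restrict (count_list xs) S"
    have "image_mset f (mset_set S) = image_mset (count_list xs) (mset_set S)"
      using assms(1) by (intro image_mset_cong) (auto simp: f_def)
    then have img: "image_mset f (mset_set S) = \<psi>'"
      using image_mset_count_list_mset_set[OF assms(1) xs(3)] xs(1) by (simp add: \<psi>'_def)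
    then have "set_mset \<psi>' = f ` S" using assms(1) by force
    then have "f \<in> assignments S \<psi>'" using img by (auto simp: assignments_def f_def)
    moreover have "(\<Sum>x\<in>S. f x) = (\<Sum>x\<in>S. count_list xs x)"
      by (intro sum.cong) (auto simp: f_def)
    moreover have "\<dots> = (\<Sum>x\<in>set xs. count_list xs x)"
      using assms(1) xs(3) by (intro sum.mono_neutral_right) (auto simp: count_list_0_iff)
    moreover have "(\<Sum>x\<in>set xs. count_list xs x) = M"
      using sum_count_set[of xs "set xs"] xs(2) by simp
    ultimately have "f \<in> A" unfolding A_def by simp
    moreover have "xs \<in> E f" by (simp add: E_def f_def)
    ultimately show "xs \<in> (\<Union>f\<in>A. E f)" by blast
  qed
  have size: "(\<Prod>k\<in>#\<psi>'. (1 / 2 :: real)) = (1 / 2) ^ card S" if "f \<in> A" for f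
  proof -
    have "image_mset f (mset_set S) = \<psi>'" using that by (simp add: A_def assignments_def)
    then have "size \<psi>' = card S" by (metis size_image_mset size_mset_set)
    then show ?thesis by simp
  qed
  have "pmf (profile_pmf M q) \<psi> = ?P {xs. profile xs = \<psi>}"
    by (simp add: profile_pmf_def pmf_map vimage_def)
  also have "\<dots> = ?P ({xs. profile xs = \<psi>} \<inter> set_pmf (replicate_pmf M q))"
    by (rule measure_Int_set_pmf[symmetric])
  also have "\<dots> \<le> ?P (\<Union>f\<in>A. E f)"
    by (intro measure_pmf.finite_measure_mono sub) auto
  also have "\<dots> \<le> (\<Sum>f\<in>A. ?P (E f))"
    using finA by (intro measure_pmf.finite_measure_subadditive_finite) auto
  also have "\<dots> \<le> (\<Sum>f\<in>A. exp 1 * real M * (\<Prod>x\<in>S. poisson_weight (real M * pmf q x) (f x)))"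
  proof (rule sum_mono)
    fix f assume "f \<in> A"
    then have f: "(\<Sum>x\<in>S. f x) = M" by (simp add: A_def)
    define W where "W = (\<Prod>x\<in>S. pmf q x ^ f x / fact (f x))"
    have "(\<Prod>x\<in>S. poisson_weight (real M * pmf q x) (f x))
        = (\<Prod>x\<in>S. exp (- (real M * pmf q x))) * (\<Prod>x\<in>S. real M ^ f x) * W"
      unfolding W_def prod.distrib[symmetric]
      by (intro prod.cong) (auto simp: poisson_weight_def power_mult_distrib)
    \<comment> \<open>The rates add up to \<open>M\<close>, because \<open>q\<close> lives on
      \<open>S\<close>.\<close>
    also have "(\<Prod>x\<in>S. exp (- (real M * pmf q x))) = exp (- real M)"
      using sum_pmf_eq_1[OF assms(1,2)] assms(1)
      by (simp add: exp_sum[symmetric] sum_negf sum_distrib_left[symmetric])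
    also have "(\<Prod>x\<in>S. real M ^ f x) = real M ^ M"
      by (simp add: power_sum[symmetric] f)
    finally have W: "(\<Prod>x\<in>S. poisson_weight (real M * pmf q x) (f x)) = exp (- real M) * real M ^ M * W" .
    have "?P (E f) = fact M * W"
      unfolding E_def W_def using assms f by (intro prob_counts_multinomial)
    also have "\<dots> \<le> exp 1 * real M * (real M ^ M * exp (- real M)) * W"
      using fact_le_exp[OF assms(3)] by (intro mult_right_mono) (auto simp: W_def intro!: prod_nonneg)
    finally show "?P (E f) \<le> exp 1 * real M * (\<Prod>x\<in>S. poisson_weight (real M * pmf q x) (f x))"
      unfolding W by (simp add: mult_ac)
  qed
  also have "\<dots> = exp 1 * real M * (\<Sum>f\<in>A. \<Prod>x\<in>S. poisson_weight (real M * pmf q x) (f x))"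
    by (simp add: sum_distrib_left)
  also have "\<dots> \<le> exp 1 * real M * (1 / 2) ^ card S"
  proof (intro mult_left_mono)
    show "(\<Sum>f\<in>A. \<Prod>x\<in>S. poisson_weight (real M * pmf q x) (f x)) \<le> (1 / 2) ^ card S"
    \<comment> \<open>If \<open>\<psi>\<close> has more than \<open>card S\<close> entries,
      truncated subtraction leaves \<open>\<psi>'\<close> too long for the intended power of
      \<open>1 / 2\<close>; but then no count vector fits and the sum is empty.\<close>
    proof (cases "A = {}")
      case False
      then obtain f where f: "f \<in> A" by blast
      have "(\<Sum>f\<in>A. \<Prod>x\<in>S. poisson_weight (real M * pmf q x) (f x))
         \<le> (\<Sum>f\<in>assignments S \<psi>'. \<Prod>x\<in>S. poisson_weight (real M * pmf q x) (f x))"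
        by (intro sum_mono2 finite_assignments assms(1))
           (auto simp: A_def intro!: prod_nonneg poisson_weight_nonneg)
      also have "\<dots> \<le> (\<Prod>k\<in>#\<psi>'. \<Sum>x\<in>S. poisson_weight (real M * pmf q x) k)"
        by (intro sum_assignments_le_prod_column_sums assms(1) poisson_weight_nonneg) auto
      also have "\<dots> \<le> (\<Prod>k\<in>#\<psi>'. 1 / 2)"
        by (intro prod_mset_mono_real load sum_nonneg poisson_weight_nonneg) auto
      finally show ?thesis using size[OF f] by simp
    qed simp
  qed simp
  finally show ?thesis .
qed

section \<open>Entropy of the profile\<close>

lemma pmf_entropy_summand_nonneg: "0 \<le> pmf p x * ln (1 / pmf p x)"
  by (cases "pmf p x = 0") (auto intro!: mult_nonneg_nonneg ln_ge_zero simp: pmf_le_1 pmf_pos)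

lemma shannon_entropy_finite:
  assumes "finite A" "set_pmf p \<subseteq> A"
  shows "shannon_entropy p = ereal (\<Sum>x\<in>A. pmf p x * ln (1 / pmf p x))"
proof -
  have "(\<integral>\<^sup>+x. ennreal (pmf p x * ln (1 / pmf p x)) \<partial>count_space UNIV)
      = (\<Sum>x\<in>A. ennreal (pmf p x * ln (1 / pmf p x)))"
  proof (rule nn_integral_count_space'[OF assms(1)])
    fix x assume "x \<in> UNIV" "x \<notin> A"
    then have "x \<notin> set_pmf p" using assms(2) by blast
    then have "pmf p x = 0" by (simp add: set_pmf_iff)
    then show "ennreal (pmf p x * ln (1 / pmf p x)) = 0" by simp
  qed simp
  also have "\<dots> = ennreal (\<Sum>x\<in>A. pmf p x * ln (1 / pmf p x))"
    by (intro sum_ennreal pmf_entropy_summand_nonneg)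
  finally show ?thesis unfolding shannon_entropy_def
    by (simp only: enn2ereal_ennreal[OF sum_nonneg[OF pmf_entropy_summand_nonneg]])
qed

lemma finite_set_profile_pmf:
  fixes p :: "'a pmf"
  shows "finite (set_pmf (profile_pmf n p))"
proof (rule finite_subset)
  show "set_pmf (profile_pmf n p) \<subseteq> mset ` {ys. set ys \<subseteq> {..n} \<and> length ys \<le> n}"
  proof
    fix \<phi> assume "\<phi> \<in> set_pmf (profile_pmf n p)"
    then have "\<exists>xs :: 'a list. \<phi> = profile xs \<and> length xs = n"
      by (auto simp: profile_pmf_def set_replicate_pmf)
    then obtain xs :: "'a list" where xs: "\<phi> = profile xs" "length xs = n" by blast
    have "\<phi> = mset (map (count_list xs) (remdups xs))"
      using mset_set_set[of "remdups xs"] by (simp add: xs profile_def)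
    moreover have "set (map (count_list xs) (remdups xs)) \<subseteq> {..n}" "length (map (count_list xs) (remdups xs)) \<le> n"
      using xs(2) by (auto simp: count_le_length length_remdups_leq)
    ultimately show "\<phi> \<in> mset ` {ys. set ys \<subseteq> {..n} \<and> length ys \<le> n}" by blast
  qed
qed (simp add: finite_lists_length_le)

lemma profile_entropy_eq_sum:
  "profile_entropy n p
     = (\<Sum>\<phi>\<in>set_pmf (profile_pmf n p). pmf (profile_pmf n p) \<phi> * ln (1 / pmf (profile_pmf n p) \<phi>))"
  unfolding profile_entropy_def
  by (subst shannon_entropy_finite[OF finite_set_profile_pmf order_refl]) simp

lemma profile_entropy_nonneg: "0 \<le> profile_entropy n p"
  unfolding profile_entropy_eq_sum by (intro sum_nonneg pmf_entropy_summand_nonneg)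

(* Entropy dominates conditional entropy, which is at least h on G. *)
lemma entropy_bind_pmf_ge:
  fixes Z :: "'b pmf" and K :: "'b \<Rightarrow> 'c pmf"
  defines "W \<equiv> bind_pmf Z K"
  assumes fin: "finite (set_pmf W)"
    and K: "\<And>z \<phi>. z \<in> set_pmf Z \<Longrightarrow> z \<in> G \<Longrightarrow> pmf (K z) \<phi> \<le> exp (- h)"
  shows "h * measure_pmf.prob Z G \<le> (\<Sum>\<phi>\<in>set_pmf W. pmf W \<phi> * ln (1 / pmf W \<phi>))"
proof -
  let ?A = "set_pmf W"
  define u where "u z = (\<Sum>\<phi>\<in>?A. pmf (K z) \<phi> * ln (1 / pmf W \<phi>))" for z
  have intK: "integrable (measure_pmf Z) (\<lambda>z. pmf (K z) \<phi>)" for \<phi>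
    by (intro measure_pmf.integrable_const_bound[where B = 1]) (auto simp: pmf_le_1)
  have nn: "0 \<le> pmf (K z) \<phi> * ln (1 / pmf W \<phi>)" if "\<phi> \<in> ?A" for z \<phi>
    using that by (intro mult_nonneg_nonneg ln_ge_zero) (auto simp: pmf_le_1 pmf_pos set_pmf_iff)
  have "(\<integral>z. h * indicator G z \<partial>measure_pmf Z) \<le> (\<integral>z. u z \<partial>measure_pmf Z)"
  proof (rule integral_mono_AE)
    show "integrable (measure_pmf Z) (\<lambda>z. h * indicator G z)"
      by (intro integrable_mult_right measure_pmf.integrable_const_bound[where B = 1])
         (auto simp: indicator_def)
    show "integrable (measure_pmf Z) u"
      unfolding u_def by (intro Bochner_Integration.integrable_sum integrable_mult_left intK)
    show "AE z in measure_pmf Z. h * indicator G z \<le> u z"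
      unfolding AE_measure_pmf_iff
    proof
      fix z assume z: "z \<in> set_pmf Z"
      show "h * indicator G z \<le> u z"
      proof (cases "z \<in> G")
        case False
        then show ?thesis by (auto simp: u_def intro!: sum_nonneg nn)
      next
        case True
        have sub: "set_pmf (K z) \<subseteq> ?A" using z by (auto simp: W_def)
        \<comment> \<open>Gibbs' inequality in pointwise form, combined with the bound
          \<open>exp (- h)\<close> on the atoms. Summed over \<open>\<phi>\<close>, the first two
          terms cancel and \<open>h\<close> remains.\<close>
        have "pmf (K z) \<phi> - pmf W \<phi> + h * pmf (K z) \<phi> \<le> pmf (K z) \<phi> * ln (1 / pmf W \<phi>)"
          if \<phi>: "\<phi> \<in> ?A" for \<phi>
        proof (cases "pmf (K z) \<phi> = 0")
          case False
          then have k: "pmf (K z) \<phi> > 0" by (simp add: pmf_pos set_pmf_iff)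
          have w: "pmf W \<phi> > 0" using \<phi> by (simp add: pmf_pos set_pmf_iff)
          have "1 - pmf W \<phi> / pmf (K z) \<phi> \<le> ln (pmf (K z) \<phi> / pmf W \<phi>)"
            using one_minus_le_ln[of "pmf (K z) \<phi> / pmf W \<phi>"] k w by simp
          moreover have "ln (pmf (K z) \<phi>) \<le> - h"
            using K[OF z True, of \<phi>] k by (metis ln_exp ln_le_cancel_iff exp_gt_zero)
          ultimately have "1 - pmf W \<phi> / pmf (K z) \<phi> + h \<le> ln (1 / pmf W \<phi>)"
            using k w by (simp add: ln_div)
          from mult_left_mono[OF this less_imp_le[OF k]] show ?thesis
            using k by (simp add: algebra_simps)
        qed simp
        then have "(\<Sum>\<phi>\<in>?A. pmf (K z) \<phi> - pmf W \<phi> + h * pmf (K z) \<phi>) \<le> u z"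
          unfolding u_def by (intro sum_mono)
        moreover have "(\<Sum>\<phi>\<in>?A. pmf (K z) \<phi>) = 1" "(\<Sum>\<phi>\<in>?A. pmf W \<phi>) = 1"
          using fin sub by (auto intro!: sum_pmf_eq_1)
        ultimately show ?thesis using True
          by (simp add: sum.distrib sum_subtractf sum_distrib_left[symmetric])
      qed
    qed
  qed
  moreover have "(\<integral>z. u z \<partial>measure_pmf Z) = (\<Sum>\<phi>\<in>?A. pmf W \<phi> * ln (1 / pmf W \<phi>))"
    unfolding u_def
    by (subst Bochner_Integration.integral_sum) (auto intro!: integrable_mult_left intK simp: W_def pmf_bind)
  ultimately show ?thesis by simp
qed

section \<open>Sampling in two stages: first the symbols outside a set, then those inside it\<close>

definition mask_symbol :: "'a set \<Rightarrow> 'a \<Rightarrow> 'a option" where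
  "mask_symbol S x = (if x \<in> S then None else Some x)"

lemma bind_mask_symbol:
  assumes "set_pmf p \<inter> S \<noteq> {}"
  shows "bind_pmf (map_pmf (mask_symbol S) p) (case_option (cond_pmf p S) return_pmf) = p"
proof (rule pmf_eqI)
  fix i
  have pos: "measure_pmf.prob p S > 0"
    using assms by (metis Int_emptyI measure_pmf_zero_iff zero_less_measure_iff)
  have "pmf (bind_pmf (map_pmf (mask_symbol S) p) (case_option (cond_pmf p S) return_pmf)) i
     = (\<integral>x. pmf (case_option (cond_pmf p S) return_pmf (mask_symbol S x)) i \<partial>measure_pmf p)"
    by (simp add: pmf_bind)
  also have "\<dots> = pmf p i"
  proof (cases "i \<in> S")
    case True
    then have "(\<lambda>x. pmf (case_option (cond_pmf p S) return_pmf (mask_symbol S x)) i)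
        = (\<lambda>x. indicator S x * (pmf p i / measure_pmf.prob p S))"
      using assms by (auto simp: mask_symbol_def fun_eq_iff pmf_cond indicator_def)
    then show ?thesis using pos by simp
  next
    case False
    then have "(\<lambda>x. pmf (case_option (cond_pmf p S) return_pmf (mask_symbol S x)) i) = indicator {i}"
      using assms by (auto simp: mask_symbol_def fun_eq_iff pmf_cond indicator_def)
    then show ?thesis by (simp add: measure_pmf_single)
  qed
  finally show "pmf (bind_pmf (map_pmf (mask_symbol S) p) (case_option (cond_pmf p S) return_pmf)) i = pmf p i" .
qed

abbreviation masked :: "'b option list \<Rightarrow> nat" where
  "masked z \<equiv> length (filter Option.is_none z)"

abbreviation unmasked :: "'b option list \<Rightarrow> 'b list" where
  "unmasked z \<equiv> map the (filter (Not \<circ> Option.is_none) z)"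

text \<open>Stated for multisets because the hidden draws are supplied together after all masks are
  known, which destroys the order. In the induction the redrawing of the first symbol commutes with
  the remaining masks by independence.\<close>

lemma map_mset_replicate_pmf_mask:
  assumes "set_pmf p \<inter> S \<noteq> {}"
  shows "map_pmf mset (replicate_pmf n p) =
    bind_pmf (replicate_pmf n (map_pmf (mask_symbol S) p))
      (\<lambda>z. map_pmf (\<lambda>ys. mset ys + mset (unmasked z)) (replicate_pmf (masked z) (cond_pmf p S)))"
proof (induction n)
  case 0
  show ?case by (simp add: bind_return_pmf)
next
  case (Suc n)
  let ?K = "\<lambda>z. map_pmf (\<lambda>ys. mset ys + mset (unmasked z)) (replicate_pmf (masked z) (cond_pmf p S))"
  let ?Z = "replicate_pmf n (map_pmf (mask_symbol S) p)"
  let ?g = "case_option (cond_pmf p S) return_pmf"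
  have cons: "?K (y # z) = bind_pmf (?g y) (\<lambda>x. map_pmf (add_mset x) (?K z))" for y z
    by (cases y) (simp_all add: map_pmf_def bind_assoc_pmf bind_return_pmf)
  have "map_pmf mset (replicate_pmf (Suc n) p)
      = bind_pmf p (\<lambda>x. map_pmf (add_mset x) (map_pmf mset (replicate_pmf n p)))"
    by (simp add: map_pmf_def bind_assoc_pmf bind_return_pmf)
  also have "\<dots> = bind_pmf (bind_pmf (map_pmf (mask_symbol S) p) ?g) (\<lambda>x. map_pmf (add_mset x) (bind_pmf ?Z ?K))"
    by (simp only: Suc bind_mask_symbol[OF assms])
  also have "\<dots> = bind_pmf (map_pmf (mask_symbol S) p) (\<lambda>y. bind_pmf (?g y) (\<lambda>x. bind_pmf ?Z (\<lambda>z. map_pmf (add_mset x) (?K z))))"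
    by (simp only: bind_assoc_pmf map_bind_pmf)
  also have "\<dots> = bind_pmf (map_pmf (mask_symbol S) p) (\<lambda>y. bind_pmf ?Z (\<lambda>z. bind_pmf (?g y) (\<lambda>x. map_pmf (add_mset x) (?K z))))"
    by (subst bind_commute_pmf) (rule refl)
  also have "\<dots> = bind_pmf (replicate_pmf (Suc n) (map_pmf (mask_symbol S) p)) ?K"
    by (simp only: cons[symmetric] replicate_pmf.simps bind_assoc_pmf bind_return_pmf)
  finally show ?case .
qed

lemma profile_eq_if_mset_eq:
  assumes "mset xs = mset ys"
  shows "profile xs = profile ys"
proof -
  have "count_list xs = count_list ys"
  proof
    show "count_list xs x = count_list ys x" for x
      using count_mset[of xs x] count_mset[of ys x] assms by simp
  qed
  then show ?thesis using mset_eq_setD[OF assms] by (simp add: profile_def)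
qed

lemma profile_append_disjoint:
  assumes "set xs \<inter> set ys = {}"
  shows "profile (xs @ ys) = profile xs + profile ys"
proof -
  have "mset_set (set (xs @ ys)) = mset_set (set xs) + mset_set (set ys)"
    using assms by (simp add: mset_set_Union)
  moreover have "image_mset (count_list (xs @ ys)) (mset_set (set xs)) = image_mset (count_list xs) (mset_set (set xs))"
    using assms by (intro image_mset_cong) (auto simp: count_list_0_iff)
  moreover have "image_mset (count_list (xs @ ys)) (mset_set (set ys)) = image_mset (count_list ys) (mset_set (set ys))"
    using assms by (intro image_mset_cong) (auto simp: count_list_0_iff)
  ultimately show ?thesis by (simp add: profile_def)
qed

text \<open>Hidden and visible symbols are disjoint, so given the masks the visible part only adds a
  fixed multiset. The conditional law of the profile is thus a translate of a profile law over
  \<open>S\<close>, to which \<open>pmf_profile_le\<close> applies.\<close>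

lemma profile_pmf_mask:
  assumes S: "set_pmf p \<inter> S \<noteq> {}"
  shows "profile_pmf n p =
    bind_pmf (replicate_pmf n (map_pmf (mask_symbol S) p))
      (\<lambda>z. map_pmf (\<lambda>\<psi>. \<psi> + profile (unmasked z)) (profile_pmf (masked z) (cond_pmf p S)))"
proof -
  \<comment> \<open>The profile depends only on the multiset of the sample; choosing a
    representative list turns it into a function of that multiset.\<close>
  define prof where "prof A = profile (SOME xs. mset xs = A)" for A :: "'a multiset"
  have prof: "prof (mset xs) = profile xs" for xs
    unfolding prof_def by (rule someI2[where a = xs]) (auto intro: profile_eq_if_mset_eq)
  have "profile_pmf n p = map_pmf prof (map_pmf mset (replicate_pmf n p))"
    by (simp add: profile_pmf_def map_pmf_comp prof)
  also have "\<dots> = bind_pmf (replicate_pmf n (map_pmf (mask_symbol S) p))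
      (\<lambda>z. map_pmf (\<lambda>ys. profile (ys @ unmasked z)) (replicate_pmf (masked z) (cond_pmf p S)))"
    by (simp add: map_mset_replicate_pmf_mask[OF S] map_bind_pmf map_pmf_comp prof[symmetric])
  also have "\<dots> = bind_pmf (replicate_pmf n (map_pmf (mask_symbol S) p))
      (\<lambda>z. map_pmf (\<lambda>\<psi>. \<psi> + profile (unmasked z)) (profile_pmf (masked z) (cond_pmf p S)))"
    unfolding profile_pmf_def map_pmf_comp
  proof (intro bind_pmf_cong refl map_pmf_cong profile_append_disjoint)
    fix z ys assume z: "z \<in> set_pmf (replicate_pmf n (map_pmf (mask_symbol S) p))"
      and ys: "ys \<in> set_pmf (replicate_pmf (masked z) (cond_pmf p S))"
    have "set ys \<subseteq> S" using ys S by (auto simp: set_replicate_pmf in_lists_conv_set)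
    moreover have "the y \<notin> S" if "y \<in> set z" "\<not> Option.is_none y" for y
      using z that by (auto simp: set_replicate_pmf in_lists_conv_set mask_symbol_def split: if_splits)
    ultimately show "set ys \<inter> set (unmasked z) = {}" by auto
  qed
  finally show ?thesis .
qed

section \<open>A set of symbols with small column sums forces profile entropy\<close>

lemma pmf_map_inj_le:
  assumes "inj f" "\<And>x. pmf q x \<le> b"
  shows "pmf (map_pmf f q) y \<le> b"
proof (cases "y \<in> range f")
  case True
  then show ?thesis using assms by (auto simp: pmf_map_inj')
next
  case False
  then have "pmf (map_pmf f q) y = 0" by (auto simp: pmf_eq_0_set_pmf)
  then show ?thesis using order_trans[OF pmf_nonneg assms(2)] by simp
qed

text \<open>With \<open>m\<close> the expected number of hits, each \<open>k < m / 4\<close> is off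
  by at least \<open>sqrt m / 2\<close> on the square-root scale, so its exponent is at least
  \<open>m / 4 \<ge> 3 + 3 * ln n\<close>. This beats the Poissonization factor
  \<open>exp 1 * n\<close> and the union over at most \<open>n + 1 \<le> 2 * n\<close> values of
  \<open>k\<close>.\<close>

lemma prob_length_filter_lower_tail:
  fixes p :: "'b pmf"
  assumes n: "n \<ge> 1" and big: "12 + 12 * ln (real n) \<le> real n * measure_pmf.prob p {x. Q x}"
  shows "measure_pmf.prob (replicate_pmf n p)
     {xs. real n * measure_pmf.prob p {x. Q x} / 4 \<le> real (length (filter Q xs))} \<ge> 1 / 2"
proof -
  define m where "m = real n * measure_pmf.prob p {x. Q x}"
  let ?P = "measure_pmf.prob (replicate_pmf n p)"
  define D where "D = {k. k \<le> n \<and> real k < m / 4}"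
  have m: "m \<ge> 0" by (simp add: m_def)
  have nr: "real n \<ge> 1" using n by simp
  have each: "?P {xs. length (filter Q xs) = k} \<le> exp (- 2) / real n" if "k \<in> D" for k
  proof -
    have "sqrt (real k) \<le> sqrt (m / 4)" using that by (simp add: D_def)
    also have "\<dots> = sqrt m / 2" by (simp add: real_sqrt_divide)
    finally have "(sqrt m / 2)\<^sup>2 \<le> (sqrt m - sqrt (real k))\<^sup>2"
      using m by (intro power_mono) auto
    then have "m / 4 \<le> (sqrt m - sqrt (real k))\<^sup>2" using m by (simp add: power_divide)
    then have e: "exp (- (sqrt m - sqrt (real k))\<^sup>2) \<le> exp (- (3 + 2 * ln (real n)))"
      using big ln_ge_zero[OF nr] unfolding m_def[symmetric] exp_le_cancel_iff by linarith
    have "?P {xs. length (filter Q xs) = k} \<le> exp 1 * real n * poisson_weight m k"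
      unfolding m_def by (rule prob_length_filter_le_poisson[OF n])
    also have "poisson_weight m k \<le> exp (- (sqrt m - sqrt (real k))\<^sup>2)"
      by (rule poisson_weight_le_exp[OF m])
    also note e
    also have "exp 1 * real n * exp (- (3 + 2 * ln (real n))) = exp (- 2) / real n"
    proof -
      have "exp (- (3 + 2 * ln (real n))) = exp (- 2 + - 1 - ln (real n) - ln (real n))" by simp
      also have "\<dots> = exp (- 2) * exp (- 1) / real n / real n"
        using nr by (simp only: exp_diff exp_add) simp
      finally show ?thesis using nr by (simp add: exp_minus field_simps)
    qed
    finally show ?thesis using nr by (simp add: mult_left_mono)
  qed
  have finD: "finite D" by (simp add: D_def)
  have "card D \<le> card {..n}" by (intro card_mono) (auto simp: D_def)
  then have cD: "real (card D) \<le> real n + 1" by simp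
  have "?P (- {xs. m / 4 \<le> real (length (filter Q xs))})
      = ?P (- {xs. m / 4 \<le> real (length (filter Q xs))} \<inter> set_pmf (replicate_pmf n p))"
    by (rule measure_Int_set_pmf[symmetric])
  also have "\<dots> \<le> ?P (\<Union>k\<in>D. {xs. length (filter Q xs) = k})"
    by (intro measure_pmf.finite_measure_mono) (auto simp: D_def set_replicate_pmf)
  also have "\<dots> \<le> (\<Sum>k\<in>D. ?P {xs. length (filter Q xs) = k})"
    using finD by (intro measure_pmf.finite_measure_subadditive_finite) auto
  also have "\<dots> \<le> real (card D) * (exp (- 2) / real n)"
    using sum_bounded_above[of D _ "exp (- 2) / real n"] each by simp
  also have "\<dots> \<le> (2 * real n) * (exp (- 2) / real n)"
    using cD nr by (intro mult_right_mono) auto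
  also have "\<dots> = 2 * (exp (- 1) * exp (- 1))" using nr by (simp add: exp_add[symmetric])
  also have "\<dots> \<le> 2 * (1 / 2 * (1 / 2))"
  proof -
    have "exp (- 1) \<le> (1 / 2 :: real)"
      using exp_ge_add_one_self[of 1] by (simp add: exp_minus field_simps)
    then show ?thesis by (intro mult_left_mono mult_mono) auto
  qed
  finally have "?P (- {xs. m / 4 \<le> real (length (filter Q xs))}) \<le> 1 / 2" by simp
  then show ?thesis unfolding m_def[symmetric] prob_pmf_Compl by simp
qed

text \<open>With probability at least \<open>1 / 2\<close>, at least a quarter of the expected
  number of draws fall into \<open>S\<close>. Given such masks every profile has probability at most
  \<open>exp (- h)\<close>, so the conditional entropy is at least \<open>h / 2\<close>. In
  \<open>load\<close>, \<open>M\<close> is the random number of draws in \<open>S\<close>, and the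
  quotient is the conditional probability of \<open>x\<close>.\<close>

lemma card_le_profile_entropy:
  assumes n: "n \<ge> 1" and S: "finite S" "S \<subseteq> set_pmf p" "S \<noteq> {}"
    and big: "12 + 12 * ln (real n) \<le> real n * measure_pmf.prob p S"
    and load: "\<And>M k. real n * measure_pmf.prob p S / 4 \<le> real M \<Longrightarrow>
      (\<Sum>x\<in>S. poisson_weight (real M * (pmf p x / measure_pmf.prob p S)) k) \<le> 1 / 2"
  shows "real (card S) * ln 2 - 1 - ln (real n) \<le> 2 * profile_entropy n p"
proof -
  define m where "m = real n * measure_pmf.prob p S"
  define h where "h = real (card S) * ln 2 - 1 - ln (real n)"
  have ne: "set_pmf p \<inter> S \<noteq> {}" using S by blast
  let ?Z = "replicate_pmf n (map_pmf (mask_symbol S) p)"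
  let ?K = "\<lambda>z. map_pmf (\<lambda>\<psi>. \<psi> + profile (unmasked z)) (profile_pmf (masked z) (cond_pmf p S))"
  define G :: "'a option list set" where "G = {z. m / 4 \<le> real (masked z)}"
  have nr: "real n \<ge> 1" using n by simp
  have m: "m > 0" using big nr unfolding m_def[symmetric] by (smt (verit) ln_ge_zero)
  have "{x. Option.is_none (mask_symbol S x)} = S" by (auto simp: mask_symbol_def)
  then have ps: "measure_pmf.prob (map_pmf (mask_symbol S) p) {y. Option.is_none y} = measure_pmf.prob p S"
    by (simp add: vimage_def)
  have G: "measure_pmf.prob ?Z G \<ge> 1 / 2"
    using prob_length_filter_lower_tail[OF n, of "map_pmf (mask_symbol S) p" Option.is_none] big
    unfolding ps G_def m_def .
  have K: "pmf (?K z) \<phi> \<le> exp (- h)" if z: "z \<in> set_pmf ?Z" "z \<in> G" for z \<phi>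
  proof (rule pmf_map_inj_le)
    fix \<psi>
    have len: "length z = n" using z(1) by (simp add: set_replicate_pmf)
    have Mle: "masked z \<le> n" using length_filter_le[of _ z] len by simp
    have Mge: "m / 4 \<le> real (masked z)" using z(2) by (simp add: G_def)
    then have "masked z \<ge> 1" using m by (cases "masked z") auto
    then have "pmf (profile_pmf (masked z) (cond_pmf p S)) \<psi> \<le> exp 1 * real (masked z) * (1 / 2) ^ card S"
    proof (intro pmf_profile_le S(1))
      show "set_pmf (cond_pmf p S) \<subseteq> S" using ne by simp
      fix k
      have "(\<Sum>x\<in>S. poisson_weight (real (masked z) * pmf (cond_pmf p S) x) k)
          = (\<Sum>x\<in>S. poisson_weight (real (masked z) * (pmf p x / measure_pmf.prob p S)) k)"
        using ne by (intro sum.cong) (auto simp: pmf_cond)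
      then show "(\<Sum>x\<in>S. poisson_weight (real (masked z) * pmf (cond_pmf p S) x) k) \<le> 1 / 2"
        using load[of "masked z" k] Mge by (simp add: m_def)
    qed
    also have "\<dots> \<le> exp 1 * real n * (1 / 2) ^ card S"
      using Mle by (intro mult_right_mono mult_left_mono) auto
    also have "\<dots> = exp (- h)"
    proof -
      have "exp (- h) = exp (1 + ln (real n) - real (card S) * ln 2)" by (simp add: h_def)
      also have "\<dots> = exp 1 * exp (ln (real n)) / exp (real (card S) * ln 2)"
        by (simp only: exp_add exp_diff)
      also have "\<dots> = exp 1 * real n / 2 ^ card S"
        using nr by (subst exp_of_nat_mult) simp
      finally show ?thesis by (simp add: power_divide)
    qed
    finally show "pmf (profile_pmf (masked z) (cond_pmf p S)) \<psi> \<le> exp (- h)" .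
  qed (simp add: inj_def)
  have "h * measure_pmf.prob ?Z G \<le> profile_entropy n p"
    unfolding profile_entropy_eq_sum
    using entropy_bind_pmf_ge[of ?Z ?K G h] finite_set_profile_pmf[of n p] K
    unfolding profile_pmf_mask[OF ne, symmetric] by blast
  moreover have "h / 2 \<le> h * measure_pmf.prob ?Z G" if "h \<ge> 0"
    using mult_left_mono[OF G that] by simp
  ultimately have "h \<le> 2 * profile_entropy n p"
    using profile_entropy_nonneg[of n p] by (cases "h \<ge> 0") linarith+
  then show ?thesis by (simp add: h_def)
qed

section \<open>Bands of symbols\<close>

lemma sum_power_finite_le:
  assumes "finite (A :: nat set)"
  shows "(\<Sum>i\<in>A. (2 / 3 :: real) ^ i) \<le> 3"
proof -
  have "(\<Sum>i\<in>A. (2 / 3 :: real) ^ i) \<le> (\<Sum>i. (2 / 3) ^ i)"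
    using assms by (intro sum_le_suminf summable_geometric) auto
  then show ?thesis by (simp add: suminf_geometric)
qed

text \<open>With truncated subtraction, \<open>j - a + (a - j)\<close> is the distance between
  \<open>j\<close> and \<open>a\<close>. Either side of \<open>a\<close> contributes at most a full
  geometric series.\<close>

lemma sum_power_distance_le:
  assumes "finite J"
  shows "(\<Sum>j\<in>J. (2 / 3 :: real) ^ (j - a + (a - j))) \<le> 6"
proof -
  let ?f = "\<lambda>j. (2 / 3 :: real) ^ (j - a + (a - j))"
  have "sum ?f J = sum ?f {j \<in> J. a \<le> j} + sum ?f {j \<in> J. j < a}"
    using assms by (subst sum.union_disjoint[symmetric]) (auto intro!: sum.cong)
  also have "sum ?f {j \<in> J. a \<le> j} = (\<Sum>i\<in>(\<lambda>j. j - a) ` {j \<in> J. a \<le> j}. (2 / 3) ^ i)"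
    by (subst sum.reindex) (auto simp: inj_on_def)
  also have "\<dots> \<le> 3" using assms by (intro sum_power_finite_le) auto
  also have "sum ?f {j \<in> J. j < a} = (\<Sum>i\<in>(\<lambda>j. a - j) ` {j \<in> J. j < a}. (2 / 3) ^ i)"
    by (subst sum.reindex) (auto simp: inj_on_def)
  also have "\<dots> \<le> 3" using assms by (intro sum_power_finite_le) auto
  finally show ?thesis by simp
qed

text \<open>Passes from Gaussian decay to geometric decay in the distance of integer parts:
  \<open>(y - 2)^2 \<ge> 0\<close> makes the exponent linear in \<open>y\<close>, and rounding
  changes the distance by less than 1.\<close>

lemma exp_neg_sq_le_power:
  fixes t u :: real
  assumes "t \<ge> 0" "u \<ge> 0"
  defines "j \<equiv> nat \<lfloor>t\<rfloor>" and "a \<equiv> nat \<lfloor>u\<rfloor>"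
  shows "exp (- (t - u)\<^sup>2 / 8) \<le> 3 * (2 / 3) ^ (j - a + (a - j))"
proof -
  define d where "d = j - a + (a - j)"
  define y where "y = \<bar>t - u\<bar>"
  have "real j \<le> t" "t < real j + 1" "real a \<le> u" "u < real a + 1"
    using assms(1,2) by (auto simp: j_def a_def)
  then have "real d - 1 \<le> y" unfolding d_def y_def by (cases "j \<le> a") (auto simp: of_nat_diff)
  moreover have "0 \<le> (y - 2)\<^sup>2" by simp
  then have "y / 2 - 1 / 2 \<le> y\<^sup>2 / 8" by (simp add: power2_eq_square algebra_simps)
  ultimately have "- (t - u)\<^sup>2 / 8 \<le> 1 + real d * (- 1 / 2)" by (simp add: y_def)
  then have "exp (- (t - u)\<^sup>2 / 8) \<le> exp (1 + real d * (- 1 / 2))" by simp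
  also have "\<dots> = exp 1 * exp (- 1 / 2) ^ d" by (simp only: exp_add exp_of_nat_mult)
  also have "\<dots> \<le> 3 * (2 / 3) ^ d"
  proof (intro mult_mono power_mono)
    show "exp (- 1 / 2) \<le> (2 / 3 :: real)"
      using exp_ge_add_one_self[of "1/2"] by (simp add: exp_minus field_simps)
  qed (use exp_le in auto)
  finally show ?thesis by (simp add: d_def)
qed

text \<open>A symbol of band \<open>j\<close> has weight \<open>O(1 / j)\<close>, so
  \<open>j / 500\<close> of them cost a constant per band; geometric decay away from band
  \<open>a\<close>, where \<open>k\<close> is located, makes the total at most
  \<open>36 * 6 / 500 < 1 / 2\<close>. The factor \<open>r\<close> accommodates the change of rates
  under conditioning.\<close>

lemma sum_poisson_weight_le_half:
  fixes t :: "'a \<Rightarrow> real"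
  assumes S: "finite S" "\<And>x. x \<in> S \<Longrightarrow> 1 \<le> t x" and r: "r \<ge> 1 / 2"
    and sparse: "\<And>j. 500 * card {x \<in> S. nat \<lfloor>t x\<rfloor> = j} \<le> j"
  shows "(\<Sum>x\<in>S. poisson_weight ((r * t x)\<^sup>2) k) \<le> 1 / 2"
proof -
  define u where "u = sqrt (real k) / r"
  define a where "a = nat \<lfloor>u\<rfloor>"
  define g where "g j = 36 / real j * (2 / 3) ^ (j - a + (a - j))" for j
  let ?b = "\<lambda>x. nat \<lfloor>t x\<rfloor>"
  have u: "u \<ge> 0" using r by (simp add: u_def)
  have each: "poisson_weight ((r * t x)\<^sup>2) k \<le> g (?b x)" if x: "x \<in> S" for x
  proof -
    have t: "t x \<ge> 1" using S(2) x .
    then have b: "1 \<le> real (?b x)" "real (?b x) \<le> t x" by (auto simp: le_nat_iff)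
    have rt: "r * t x > 0" using r t by (intro mult_pos_pos) auto
    have "poisson_weight ((r * t x)\<^sup>2) k \<le> 6 / (r * t x) * exp (- (r * t x - sqrt (real k))\<^sup>2 / 2)"
      using poisson_weight_le_gauss[of "(r * t x)\<^sup>2" k] rt r t by simp
    also have "\<dots> \<le> 12 / real (?b x) * exp (- (t x - u)\<^sup>2 / 8)"
    proof (intro mult_mono)
      have "1 / 2 * real (?b x) \<le> r * t x" using r b by (intro mult_mono) auto
      then have "6 / (r * t x) \<le> 6 / (1 / 2 * real (?b x))" using b by (intro divide_left_mono) (auto intro!: mult_pos_pos rt)
      then show "6 / (r * t x) \<le> 12 / real (?b x)" by simp
      have "(1 / 2)\<^sup>2 \<le> r\<^sup>2" using r by (intro power_mono) auto
      then have "(1 / 2)\<^sup>2 * (t x - u)\<^sup>2 \<le> r\<^sup>2 * (t x - u)\<^sup>2" by (intro mult_right_mono) auto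
      also have "\<dots> = (r * (t x - u))\<^sup>2" by (simp add: power_mult_distrib)
      also have "r * (t x - u) = r * t x - sqrt (real k)" using r by (simp add: u_def algebra_simps)
      finally show "exp (- (r * t x - sqrt (real k))\<^sup>2 / 2) \<le> exp (- (t x - u)\<^sup>2 / 8)"
        by (simp add: power_divide)
    qed (use b in auto)
    also have "\<dots> \<le> 12 / real (?b x) * (3 * (2 / 3) ^ (?b x - a + (a - ?b x)))"
      using exp_neg_sq_le_power[of "t x" u] t u by (intro mult_left_mono) (auto simp: a_def)
    finally show ?thesis by (simp add: g_def)
  qed
  have "(\<Sum>x\<in>S. poisson_weight ((r * t x)\<^sup>2) k) \<le> (\<Sum>x\<in>S. g (?b x))"
    by (intro sum_mono each)
  also have "\<dots> = (\<Sum>j\<in>?b ` S. \<Sum>x\<in>{x \<in> S. ?b x = j}. g (?b x))"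
    using S(1) by (intro sum.group[symmetric]) auto
  also have "\<dots> = (\<Sum>j\<in>?b ` S. real (card {x \<in> S. ?b x = j}) * g j)"
    by (intro sum.cong refl) simp
  also have "\<dots> \<le> (\<Sum>j\<in>?b ` S. 36 / 500 * (2 / 3) ^ (j - a + (a - j)))"
  proof (rule sum_mono)
    fix j assume "j \<in> ?b ` S"
    then obtain x where x: "x \<in> S" "j = ?b x" by blast
    have j: "j \<ge> 1" using S(2)[OF x(1)] unfolding x(2) by linarith
    have "real (500 * card {x \<in> S. ?b x = j}) \<le> real j" using sparse by (simp only: of_nat_le_iff)
    then have "real (card {x \<in> S. ?b x = j}) * (36 / real j) \<le> 36 / 500"
      using j by (simp add: field_simps)
    then show "real (card {x \<in> S. ?b x = j}) * g j \<le> 36 / 500 * (2 / 3) ^ (j - a + (a - j))"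
      unfolding g_def mult.assoc[symmetric] by (intro mult_right_mono) auto
  qed
  also have "\<dots> = 36 / 500 * (\<Sum>j\<in>?b ` S. (2 / 3) ^ (j - a + (a - j)))"
    by (simp add: sum_distrib_left)
  also have "\<dots> \<le> 36 / 500 * 6"
    using S(1) by (intro mult_left_mono sum_power_distance_le) auto
  finally show ?thesis by simp
qed

lemma finite_pmf_ge:
  assumes "e > 0"
  shows "finite {x. e \<le> pmf p x}"
proof (rule ccontr)
  assume "infinite {x. e \<le> pmf p x}"
  then obtain A where A: "A \<subseteq> {x. e \<le> pmf p x}" "finite A" "card A = Suc (nat \<lceil>1 / e\<rceil>)"
    using infinite_arbitrarily_large by metis
  have "1 / e < real (card A)" unfolding A(3) by linarith
  then have "1 < real (card A) * e" using assms by (simp add: field_simps)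
  also have "\<dots> \<le> (\<Sum>x\<in>A. pmf p x)" using A(1) by (intro sum_bounded_below) auto
  also have "\<dots> \<le> 1" using A(2) by (simp flip: measure_measure_pmf_finite)
  finally show False by simp
qed

text \<open>On the square-root scale counts fluctuate equally at all probabilities, so unit
  intervals suit all symbols. Band 0 contains every symbol of probability 0 and may be
  infinite.\<close>

definition band :: "nat \<Rightarrow> 'a pmf \<Rightarrow> nat \<Rightarrow> 'a set" where
  "band n p j = {x. nat \<lfloor>sqrt (real n * pmf p x)\<rfloor> = j}"

lemma finite_band:
  assumes "j \<ge> 1"
  shows "finite (band n p j)"
proof (cases "n = 0")
  case True
  then show ?thesis using assms by (simp add: band_def)
next
  case False
  have "1 / real n \<le> pmf p x" if "x \<in> band n p j" for x
  proof -
    have "1 \<le> sqrt (real n * pmf p x)" using that assms by (auto simp: band_def le_nat_iff)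
    then show ?thesis using False by (simp add: field_simps)
  qed
  then show ?thesis using False by (intro finite_subset[OF _ finite_pmf_ge[of "1 / real n" p]]) auto
qed

lemma card_nat_between_le:
  fixes a b :: real
  assumes "V \<subseteq> {k. a \<le> real k \<and> real k \<le> b}" "0 \<le> a" "a \<le> b"
  shows "real (card V) \<le> b - a + 1"
proof -
  have "V \<subseteq> {nat \<lceil>a\<rceil>..nat \<lfloor>b\<rfloor>}"
    using assms(1) by (auto simp: nat_le_iff le_nat_iff ceiling_le_iff le_floor_iff)
  then have "card V \<le> card {nat \<lceil>a\<rceil>..nat \<lfloor>b\<rfloor>}" by (intro card_mono) auto
  then have "card V \<le> Suc (nat \<lfloor>b\<rfloor>) - nat \<lceil>a\<rceil>" by simp
  then show ?thesis using assms(2,3) by linarith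
qed

lemma dimension_profile: "dimension (profile xs) = card (count_list xs ` set xs)"
  by (simp add: dimension_def profile_def)

text \<open>Counts of symbols below band \<open>j0\<close> are at most \<open>(j0 + R)^2\<close>,
  hence so is the number of their values. In a higher band \<open>j\<close>, the distinct counts are
  no more than the symbols, and no more than the \<open>O(R * j)\<close> integers between
  \<open>(j - R)^2\<close> and \<open>(j + 1 + R)^2\<close>.\<close>

lemma dimension_le_sum_bands:
  fixes p :: "'a pmf"
  assumes R: "R \<ge> 3" and j0: "R \<le> real j0" "500 \<le> j0"
    and conc: "\<And>x. x \<in> set xs \<Longrightarrow> \<bar>sqrt (real (count_list xs x)) - sqrt (real n * pmf p x)\<bar> \<le> R"
  shows "real (dimension (profile xs)) \<le> (real j0 + R)\<^sup>2
     + 9000 * R * (\<Sum>j = j0..nat \<lfloor>sqrt (real n)\<rfloor>. real (min (card (band n p j)) (j div 500)))"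
proof -
  \<comment> \<open>Probabilities are at most 1, so no symbol lies in a band beyond
    \<open>J\<close>.\<close>
  define J where "J = nat \<lfloor>sqrt (real n)\<rfloor>"
  define V where "V j = count_list xs ` (set xs \<inter> band n p j)" for j
  define L where "L = count_list xs ` {x \<in> set xs. sqrt (real n * pmf p x) < real j0}"
  have cover: "count_list xs ` set xs \<subseteq> L \<union> (\<Union>j\<in>{j0..J}. V j)"
  proof
    fix k assume "k \<in> count_list xs ` set xs"
    then obtain x where x: "x \<in> set xs" "k = count_list xs x" by blast
    show "k \<in> L \<union> (\<Union>j\<in>{j0..J}. V j)"
    proof (cases "sqrt (real n * pmf p x) < real j0")
      case False
      have "real n * pmf p x \<le> real n * 1" by (intro mult_left_mono pmf_le_1) auto
      then have "nat \<lfloor>sqrt (real n * pmf p x)\<rfloor> \<le> J"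
        unfolding J_def by (intro nat_mono floor_mono real_sqrt_le_mono) simp
      moreover have "j0 \<le> nat \<lfloor>sqrt (real n * pmf p x)\<rfloor>" using False by (simp add: le_nat_iff le_floor_iff)
      ultimately show ?thesis using x by (auto simp: V_def band_def)
    qed (use x in \<open>auto simp: L_def\<close>)
  qed
  have L: "real (card L) \<le> (real j0 + R)\<^sup>2"
  proof -
    have "L \<subseteq> {1..nat \<lfloor>(real j0 + R)\<^sup>2\<rfloor>}"
    proof
      fix k assume "k \<in> L"
      then obtain x where x: "x \<in> set xs" "k = count_list xs x" "sqrt (real n * pmf p x) < real j0"
        by (auto simp: L_def)
      have "sqrt (real k) \<le> real j0 + R" using conc[OF x(1)] x(3) unfolding x(2) by linarith
      then have "real k \<le> (real j0 + R)\<^sup>2" by (rule sqrt_le_D)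
      moreover have "k \<noteq> 0" using x by (simp add: count_list_0_iff)
      ultimately show "k \<in> {1..nat \<lfloor>(real j0 + R)\<^sup>2\<rfloor>}" by (simp add: le_nat_iff le_floor_iff)
    qed
    then have "card L \<le> nat \<lfloor>(real j0 + R)\<^sup>2\<rfloor>" using card_mono[of "{1..nat \<lfloor>(real j0 + R)\<^sup>2\<rfloor>}" L] by simp
    then show ?thesis using zero_le_power2[of "real j0 + R"] by linarith
  qed
  have V: "real (card (V j)) \<le> 9000 * R * real (min (card (band n p j)) (j div 500))" if j: "j \<in> {j0..J}" for j
  proof -
    have j: "j \<ge> 500" "R \<le> real j" using j j0 by auto
    have "card (V j) \<le> card (set xs \<inter> band n p j)" unfolding V_def by (intro card_image_le) auto
    also have "\<dots> \<le> card (band n p j)" using j by (intro card_mono finite_band) auto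
    finally have 1: "real (card (V j)) \<le> real (card (band n p j))" by simp
    have "V j \<subseteq> {k. (real j - R)\<^sup>2 \<le> real k \<and> real k \<le> (real j + 1 + R)\<^sup>2}"
    proof
      fix k assume "k \<in> V j"
      then obtain x where x: "x \<in> set xs" "x \<in> band n p j" "k = count_list xs x" by (auto simp: V_def)
      have "nat \<lfloor>sqrt (real n * pmf p x)\<rfloor> = j" using x(2) by (simp add: band_def)
      then have "real j \<le> sqrt (real n * pmf p x)" "sqrt (real n * pmf p x) < real j + 1"
        using j by linarith+
      then have k: "real j - R \<le> sqrt (real k)" "sqrt (real k) \<le> real j + 1 + R"
        using conc[OF x(1)] unfolding x(3) by linarith+
      have "(real j - R)\<^sup>2 \<le> (sqrt (real k))\<^sup>2" using k(1) j by (intro power_mono) auto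
      moreover have "(sqrt (real k))\<^sup>2 \<le> (real j + 1 + R)\<^sup>2" using k(2) by (intro power_mono) auto
      ultimately show "k \<in> {k. (real j - R)\<^sup>2 \<le> real k \<and> real k \<le> (real j + 1 + R)\<^sup>2}" by simp
    qed
    then have "real (card (V j)) \<le> (real j + 1 + R)\<^sup>2 - (real j - R)\<^sup>2 + 1"
      using R j by (intro card_nat_between_le) (auto intro!: power_mono)
    also have "\<dots> = (2 * R + 1) * (2 * real j + 1) + 1" by (simp add: power2_eq_square algebra_simps)
    also have "\<dots> \<le> (7 / 3 * R) * (3 * real j) + 1" using R j by (intro add_mono mult_mono) auto
    also have "\<dots> \<le> 9 * (R * real j)" using R j mult_mono[of 1 R 1 "real j"] by simp
    also have "\<dots> \<le> 9 * (R * (1000 * real (j div 500)))"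
    proof -
      \<comment> \<open>For \<open>j \<ge> 500\<close>, rounding \<open>j / 500\<close> down loses
        at most a factor 2.\<close>
      have "500 \<le> 500 * (j div 500)" using j div_le_mono[of 500 j 500] by simp
      then have "j \<le> 1000 * (j div 500)"
        using mult_div_mod_eq[of 500 j] mod_less_divisor[of 500 j] by linarith
      then have "real j \<le> real (1000 * (j div 500))" by (simp only: of_nat_le_iff)
      then show ?thesis using R by (intro mult_left_mono) auto
    qed
    finally have 2: "real (card (V j)) \<le> 9000 * R * real (j div 500)" by simp
    have "1 * real (card (band n p j)) \<le> 9000 * R * real (card (band n p j))"
      using R by (intro mult_right_mono) auto
    with 1 2 show ?thesis by (cases "card (band n p j) \<le> j div 500") (simp_all add: min_def)
  qed
  have "card (count_list xs ` set xs) \<le> card (L \<union> (\<Union>j\<in>{j0..J}. V j))"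
    using cover by (intro card_mono) (auto simp: L_def V_def)
  also have "\<dots> \<le> card L + (\<Sum>j\<in>{j0..J}. card (V j))"
    by (intro order_trans[OF card_Un_le] add_mono card_UN_le) auto
  finally have "real (dimension (profile xs)) \<le> real (card L) + (\<Sum>j\<in>{j0..J}. real (card (V j)))"
    unfolding dimension_profile by (metis of_nat_add of_nat_le_iff of_nat_sum)
  also have "\<dots> \<le> (real j0 + R)\<^sup>2 + (\<Sum>j\<in>{j0..J}. 9000 * R * real (min (card (band n p j)) (j div 500)))"
    by (intro add_mono L sum_mono V)
  finally show ?thesis by (simp add: sum_distrib_left J_def)
qed

text \<open>Filling every band up to the cap \<open>j div 500\<close> meets the sparsity condition
  of \<open>sum_poisson_weight_le_half\<close> and at the same time gives \<open>S\<close> exactly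
  the size that bounds the dimension in \<open>dimension_le_sum_bands\<close>.\<close>

lemma obtain_sparse_set:
  fixes p :: "'a pmf"
  assumes "j0 \<ge> 1"
  obtains S where "finite S" "\<And>x. x \<in> S \<Longrightarrow> real j0 \<le> sqrt (real n * pmf p x)"
    "\<And>j. 500 * card {x \<in> S. nat \<lfloor>sqrt (real n * pmf p x)\<rfloor> = j} \<le> j"
    "card S = (\<Sum>j = j0..J. min (card (band n p j)) (j div 500))"
proof -
  have "\<exists>T. \<forall>j\<in>{j0..J}. T j \<subseteq> band n p j \<and> card (T j) = min (card (band n p j)) (j div 500)"
    by (intro bchoice ballI) (meson min.cobounded1 obtain_subset_with_card_n)
  then obtain T where T: "\<And>j. j \<in> {j0..J} \<Longrightarrow> T j \<subseteq> band n p j"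
      "\<And>j. j \<in> {j0..J} \<Longrightarrow> card (T j) = min (card (band n p j)) (j div 500)"
    by blast
  have fin: "finite (T j)" if "j \<in> {j0..J}" for j
    using finite_subset[OF T(1)[OF that] finite_band] that assms by simp
  define S where "S = (\<Union>j\<in>{j0..J}. T j)"
  have floor_T: "nat \<lfloor>sqrt (real n * pmf p x)\<rfloor> = j" if "j \<in> {j0..J}" "x \<in> T j" for j x
    using T(1)[OF that(1)] that(2) by (auto simp: band_def)
  have restr: "{x \<in> S. nat \<lfloor>sqrt (real n * pmf p x)\<rfloor> = j} = (if j \<in> {j0..J} then T j else {})" for j
    using floor_T unfolding S_def by auto
  show thesis
  proof
    show "finite S" using fin by (auto simp: S_def)
    show "real j0 \<le> sqrt (real n * pmf p x)" if "x \<in> S" for x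
    proof -
      obtain j where "j \<in> {j0..J}" "nat \<lfloor>sqrt (real n * pmf p x)\<rfloor> = j"
        using \<open>x \<in> S\<close> floor_T unfolding S_def by auto
      then show ?thesis using assms by auto linarith
    qed
    show "500 * card {x \<in> S. nat \<lfloor>sqrt (real n * pmf p x)\<rfloor> = j} \<le> j" for j
      using T(2)[of j] by (auto simp: restr)
    show "card S = (\<Sum>j = j0..J. min (card (band n p j)) (j div 500))"
    proof -
      have "T i \<inter> T j = {}" if "i \<in> {j0..J}" "j \<in> {j0..J}" "i \<noteq> j" for i j
        using floor_T that by blast
      then show ?thesis using fin T(2) by (simp add: S_def card_UN_disjoint)
    qed
  qed
qed

section \<open>Dimension and entropy of the profile\<close>

text \<open>The leading factor \<open>l\<close> makes a union bound over infinitely many symbols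
  summable. It is free for \<open>l \<ge> 1\<close>. For \<open>l < 1\<close> it comes from
  \<open>l ^ k \<le> l\<close>, and the weight of rate 1 at \<open>k\<close> supplies the decay;
  moving the rate to 1 costs at most 1 of the deviation.\<close>

lemma poisson_weight_deviation_le:
  assumes "l \<ge> 0" "k \<ge> 1" "R \<ge> 1" "\<bar>sqrt (real k) - sqrt l\<bar> > R"
  shows "poisson_weight l k \<le> l * (exp 1 * exp (- (R - 1)\<^sup>2))"
proof (cases "l \<ge> 1")
  case True
  have "R\<^sup>2 \<le> \<bar>sqrt (real k) - sqrt l\<bar>\<^sup>2" using assms by (intro power_mono) auto
  moreover have "(R - 1)\<^sup>2 \<le> R\<^sup>2" using assms by (intro power_mono) auto
  ultimately have "(R - 1)\<^sup>2 \<le> (sqrt l - sqrt (real k))\<^sup>2" by (simp add: power2_commute)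
  then have "exp (- (sqrt l - sqrt (real k))\<^sup>2) \<le> exp (- (R - 1)\<^sup>2)" by simp
  with poisson_weight_le_exp[OF assms(1), of k] have "poisson_weight l k \<le> 1 * (1 * exp (- (R - 1)\<^sup>2))"
    by linarith
  also have "\<dots> \<le> l * (exp 1 * exp (- (R - 1)\<^sup>2))"
    using True by (intro mult_mono) auto
  finally show ?thesis .
next
  case False
  have "sqrt l \<le> 1" "sqrt (real k) \<ge> 1" using False assms by auto
  moreover have "sqrt l \<ge> 0" using assms by simp
  ultimately have "R - 1 \<le> sqrt (real k) - 1" using assms(4) by linarith
  then have "(R - 1)\<^sup>2 \<le> (sqrt (real k) - 1)\<^sup>2" using assms by (intro power_mono) auto
  then have e: "exp (- (sqrt 1 - sqrt (real k))\<^sup>2) \<le> exp (- (R - 1)\<^sup>2)"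
    by (simp add: power2_commute)
  obtain i where k: "k = Suc i" using assms by (cases k) auto
  have "exp (- l) * l ^ k \<le> 1 * (l * 1)"
    unfolding k power_Suc using assms False by (intro mult_mono power_le_one) auto
  then have "poisson_weight l k \<le> l / fact k"
    unfolding poisson_weight_def by (intro divide_right_mono) auto
  also have "\<dots> = l * (exp 1 * poisson_weight 1 k)"
    by (simp add: poisson_weight_def exp_minus)
  also have "\<dots> \<le> l * (exp 1 * exp (- (R - 1)\<^sup>2))"
    using order_trans[OF poisson_weight_le_exp[of 1 k] e] assms by (intro mult_left_mono) auto
  finally show ?thesis .
qed

(* A union bound whose terms are summable because they are dominated by a distribution. *)
lemma prob_UN_le:
  fixes R :: "'b pmf" and p :: "'a pmf"
  assumes B: "\<And>x. x \<in> set_pmf p \<Longrightarrow> measure_pmf.prob R (B x) \<le> pmf p x * \<delta>" and \<delta>: "\<delta> \<ge> 0"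
  shows "measure_pmf.prob R (\<Union>x\<in>set_pmf p. B x) \<le> \<delta>"
proof -
  \<comment> \<open>Assigning every outcome to one chosen index makes the events disjoint, so
    additivity over the countable support applies.\<close>
  define C where "C x = {y \<in> B x. x = (SOME x. x \<in> set_pmf p \<and> y \<in> B x)}" for x
  have eq: "(\<Union>x\<in>set_pmf p. B x) = (\<Union>x\<in>set_pmf p. C x)"
  proof (intro equalityI subsetI)
    fix y assume "y \<in> (\<Union>x\<in>set_pmf p. B x)"
    then have "\<exists>x. x \<in> set_pmf p \<and> y \<in> B x" by blast
    from someI_ex[OF this] show "y \<in> (\<Union>x\<in>set_pmf p. C x)" by (auto simp: C_def)
  qed (auto simp: C_def)
  have "emeasure (measure_pmf R) (\<Union>x\<in>set_pmf p. C x)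
      = (\<integral>\<^sup>+x. emeasure (measure_pmf R) (C x) \<partial>count_space (set_pmf p))"
    by (intro emeasure_UN_countable) (auto simp: disjoint_family_on_def C_def)
  also have "\<dots> \<le> (\<integral>\<^sup>+x. ennreal (pmf p x) * ennreal \<delta> \<partial>count_space (set_pmf p))"
  proof (rule nn_integral_mono)
    fix x assume "x \<in> space (count_space (set_pmf p))"
    then have "measure_pmf.prob R (B x) \<le> pmf p x * \<delta>" by (intro B) simp
    moreover have "measure_pmf.prob R (C x) \<le> measure_pmf.prob R (B x)"
      by (intro measure_pmf.finite_measure_mono) (auto simp: C_def)
    ultimately have "measure_pmf.prob R (C x) \<le> pmf p x * \<delta>" by linarith
    then show "emeasure (measure_pmf R) (C x) \<le> ennreal (pmf p x) * ennreal \<delta>"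
      by (simp add: measure_pmf.emeasure_eq_measure \<delta> flip: ennreal_mult')
  qed
  also have "\<dots> = (\<integral>\<^sup>+x. ennreal (pmf p x) \<partial>count_space (set_pmf p)) * ennreal \<delta>"
    by (intro nn_integral_multc) simp
  also have "\<dots> = ennreal \<delta>"
    by (simp add: nn_integral_pmf emeasure_pmf)
  finally show ?thesis
    unfolding eq using \<delta> by (simp add: measure_pmf.emeasure_eq_measure)
qed

text \<open>\<open>R\<close> is chosen so that \<open>(R - 1)^2 \<ge> 4 + 4 * ln n\<close>. This
  outweighs three factors \<open>n\<close>, from Poissonization, from the rate
  \<open>n * pmf p x\<close> and from the number of possible counts, and still leaves
  \<open>pmf p x / n\<close> for each symbol.\<close>

lemma prob_counts_concentrated:
  assumes n: "n \<ge> 1" and R: "R = 1 + 2 * (1 + ln (real n))"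
  shows "measure_pmf.prob (replicate_pmf n p)
     {xs. \<forall>x\<in>set xs. \<bar>sqrt (real (count_list xs x)) - sqrt (real n * pmf p x)\<bar> \<le> R} \<ge> 1 - 1 / real n"
proof -
  let ?P = "measure_pmf.prob (replicate_pmf n p)"
  let ?E = "{xs. \<forall>x\<in>set xs. \<bar>sqrt (real (count_list xs x)) - sqrt (real n * pmf p x)\<bar> \<le> R}"
  define bad where "bad x = {k \<in> {1..n}. \<bar>sqrt (real k) - sqrt (real n * pmf p x)\<bar> > R}" for x
  define B where "B x = (\<Union>k\<in>bad x. {xs. count_list xs x = k})" for x
  have nr: "real n \<ge> 1" using n by simp
  have lnn: "ln (real n) \<ge> 0" using nr by simp
  have R1: "R \<ge> 1" using lnn by (simp add: R)
  have small: "exp 1 * real n * real n * real n * (exp 1 * exp (- (R - 1)\<^sup>2)) \<le> 1 / real n"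
  proof -
    have "1 + ln (real n) \<le> (1 + ln (real n)) * (1 + ln (real n))"
      using lnn mult_mono[of 1 "1 + ln (real n)" "1 + ln (real n)" "1 + ln (real n)"] by simp
    moreover have "(R - 1)\<^sup>2 = 4 * ((1 + ln (real n)) * (1 + ln (real n)))"
      by (simp add: R power2_eq_square algebra_simps)
    ultimately have "4 + 4 * ln (real n) \<le> (R - 1)\<^sup>2" by linarith
    then have "exp (- (R - 1)\<^sup>2) \<le> exp (- 1 + - 1 - ln (real n) - ln (real n) - ln (real n) - ln (real n))"
      by simp
    also have "\<dots> = exp (- 1) * exp (- 1) / real n / real n / real n / real n"
      using nr by (simp only: exp_diff exp_add) simp
    finally have "exp 1 * real n * real n * real n * (exp 1 * exp (- (R - 1)\<^sup>2))
       \<le> exp 1 * real n * real n * real n * (exp 1 * (exp (- 1) * exp (- 1) / real n / real n / real n / real n))"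
      by (intro mult_left_mono) auto
    also have "\<dots> = 1 / real n" using nr by (simp add: exp_minus field_simps)
    finally show ?thesis .
  qed
  have "?P (B x) \<le> pmf p x * (1 / real n)" for x
  proof -
    have "?P (B x) \<le> (\<Sum>k\<in>bad x. ?P {xs. count_list xs x = k})"
      unfolding B_def by (intro measure_pmf.finite_measure_subadditive_finite) (auto simp: bad_def)
    also have "\<dots> \<le> (\<Sum>k\<in>bad x. exp 1 * real n * (real n * pmf p x * (exp 1 * exp (- (R - 1)\<^sup>2))))"
    proof (rule sum_mono)
      fix k assume k: "k \<in> bad x"
      have "{y. x = y} = {x}" by auto
      then have "?P {xs. count_list xs x = k} \<le> exp 1 * real n * poisson_weight (real n * pmf p x) k"
        using prob_length_filter_le_poisson[OF n, of p "(=) x" k]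
        by (simp add: count_list_eq_length_filter measure_pmf_single)
      also have "\<dots> \<le> exp 1 * real n * (real n * pmf p x * (exp 1 * exp (- (R - 1)\<^sup>2)))"
        using k R1 by (intro mult_left_mono poisson_weight_deviation_le) (auto simp: bad_def)
      finally show "?P {xs. count_list xs x = k} \<le> exp 1 * real n * (real n * pmf p x * (exp 1 * exp (- (R - 1)\<^sup>2)))" .
    qed
    also have "\<dots> = real (card (bad x)) * (exp 1 * real n * (real n * pmf p x * (exp 1 * exp (- (R - 1)\<^sup>2))))"
      by simp
    also have "card (bad x) \<le> card {1..n}" by (intro card_mono) (auto simp: bad_def)
    then have "real (card (bad x)) * (exp 1 * real n * (real n * pmf p x * (exp 1 * exp (- (R - 1)\<^sup>2))))
       \<le> real n * (exp 1 * real n * (real n * pmf p x * (exp 1 * exp (- (R - 1)\<^sup>2))))"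
      by (intro mult_right_mono) auto
    also have "\<dots> = pmf p x * (exp 1 * real n * real n * real n * (exp 1 * exp (- (R - 1)\<^sup>2)))"
      by (simp add: mult_ac)
    also have "\<dots> \<le> pmf p x * (1 / real n)" using small by (intro mult_left_mono) auto
    finally show ?thesis .
  qed
  then have "?P (\<Union>x\<in>set_pmf p. B x) \<le> 1 / real n" by (intro prob_UN_le) auto
  moreover have "?P (- ?E) \<le> ?P (\<Union>x\<in>set_pmf p. B x)"
  proof -
    have "- ?E \<inter> set_pmf (replicate_pmf n p) \<subseteq> (\<Union>x\<in>set_pmf p. B x)"
    proof
      fix xs assume "xs \<in> - ?E \<inter> set_pmf (replicate_pmf n p)"
      then obtain x where x: "x \<in> set xs" "\<bar>sqrt (real (count_list xs x)) - sqrt (real n * pmf p x)\<bar> > R"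
        and xs: "set xs \<subseteq> set_pmf p" "length xs = n"
        by (force simp: set_replicate_pmf not_le)
      have "count_list xs x \<noteq> 0" using x(1) by (simp add: count_list_0_iff)
      then have "count_list xs x \<in> bad x" using x xs count_le_length[of xs x] by (simp add: bad_def)
      then show "xs \<in> (\<Union>x\<in>set_pmf p. B x)" using x xs unfolding B_def by blast
    qed
    then have "?P (- ?E \<inter> set_pmf (replicate_pmf n p)) \<le> ?P (\<Union>x\<in>set_pmf p. B x)"
      by (intro measure_pmf.finite_measure_mono) auto
    then show ?thesis by (simp only: measure_Int_set_pmf)
  qed
  ultimately show ?thesis unfolding prob_pmf_Compl by linarith
qed

lemma prob_dimension_le_entropy:
  assumes n: "n \<ge> 1"
  shows "measure_pmf.prob (replicate_pmf n p)
     {xs. real (dimension (profile xs)) \<le> 400000 * (1 + ln (real n))\<^sup>2 * (1 + profile_entropy n p)}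
     \<ge> 1 - 1 / real n"
proof -
  define l where "l = 1 + ln (real n)"
  define H where "H = profile_entropy n p"
  define R where "R = 1 + 2 * (1 + ln (real n))"
  \<comment> \<open>At least 500, so that the cap \<open>j div 500\<close> is positive from
    \<open>j0\<close> on, and at least \<open>R\<close>, so that \<open>j - R\<close> stays
    nonnegative. Since also \<open>j0 * j0 \<ge> 500 * R\<close>, a single symbol of
    \<open>S\<close> already has the expected count required by
    \<open>card_le_profile_entropy\<close>.\<close>
  define j0 where "j0 = nat \<lceil>R\<rceil> + 500"
  define t where "t x = sqrt (real n * pmf p x)" for x
  have nr: "real n \<ge> 1" using n by simp
  have l: "l \<ge> 1" using nr by (simp add: l_def)
  have H: "H \<ge> 0" unfolding H_def by (rule profile_entropy_nonneg)
  have R: "R = 1 + 2 * l" by (simp add: R_def l_def)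
  have R3: "R \<ge> 3" "R \<le> 3 * l" using l by (auto simp: R)
  have j0: "real j0 \<ge> R" "j0 \<ge> 500" "real j0 \<ge> 500" "real j0 \<le> R + 501"
    using R3 unfolding j0_def by linarith+
  obtain S where S: "finite S" "\<And>x. x \<in> S \<Longrightarrow> real j0 \<le> t x"
    "\<And>j. 500 * card {x \<in> S. nat \<lfloor>t x\<rfloor> = j} \<le> j"
    "card S = (\<Sum>j = j0..nat \<lfloor>sqrt (real n)\<rfloor>. min (card (band n p j)) (j div 500))"
    unfolding t_def using obtain_sparse_set[of j0 n p] j0 by auto
  have card: "real (card S) \<le> 4 * H + 2 * l"
  proof (cases "S = {}")
    case True
    then show ?thesis using H l by simp
  next
    case False
    then obtain x0 where x0: "x0 \<in> S" by blast
    define \<theta> where "\<theta> = measure_pmf.prob p S"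
    have tpos: "1 \<le> t x" if "x \<in> S" for x using S(2)[OF that] j0 by linarith
    have pos: "pmf p x > 0" if "x \<in> S" for x
      using tpos[OF that] by (cases "pmf p x = 0") (auto simp: t_def pmf_nonneg order.not_eq_order_implies_strict)
    have "12 + 12 * ln (real n) \<le> 500 * R" using nr l by (simp add: R_def l_def)
    also have "\<dots> \<le> real j0 * real j0" using j0 R3 by (intro mult_mono) auto
    also have "\<dots> \<le> t x0 * t x0" using S(2)[OF x0] by (intro mult_mono) (auto simp: t_def)
    also have "\<dots> = real n * pmf p x0" by (simp add: t_def)
    also have "\<dots> \<le> real n * \<theta>"
      unfolding \<theta>_def measure_pmf_single[symmetric]
      using x0 by (intro mult_left_mono measure_pmf.finite_measure_mono) auto
    finally have big: "12 + 12 * ln (real n) \<le> real n * \<theta>" .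
    then have \<theta>n: "real n * \<theta> > 0" using nr l unfolding l_def by linarith
    then have \<theta>: "\<theta> > 0" using nr by (simp add: zero_less_mult_iff)
    have "real (card S) * ln 2 - 1 - ln (real n) \<le> 2 * H"
      unfolding H_def
    proof (rule card_le_profile_entropy[where p = p, OF n S(1) _ False, folded \<theta>_def])
      show "S \<subseteq> set_pmf p" by (auto simp: set_pmf_iff dest: pos)
      show "12 + 12 * ln (real n) \<le> real n * \<theta>" by (rule big)
      fix M k assume M: "real n * \<theta> / 4 \<le> real M"
      \<comment> \<open>Given \<open>M\<close> draws in \<open>S\<close>, the rate of
        \<open>x\<close> is \<open>M * pmf p x / \<theta> = (r * t x)^2\<close>; a quarter of the
        expected number of draws corresponds to \<open>r = 1 / 2\<close>.\<close>
      define r where "r = sqrt (real M / (real n * \<theta>))"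
      have "1 / 4 \<le> real M / (real n * \<theta>)" using M \<theta>n by (simp add: field_simps)
      then have "sqrt (1 / 4) \<le> r" unfolding r_def by (rule real_sqrt_le_mono)
      then have r: "1 / 2 \<le> r" by (simp add: real_sqrt_divide)
      have "(r * t x)\<^sup>2 = real M * (pmf p x / \<theta>)" for x
        using nr \<theta> by (simp add: r_def t_def power_mult_distrib)
      then show "(\<Sum>x\<in>S. poisson_weight (real M * (pmf p x / \<theta>)) k) \<le> 1 / 2"
        using sum_poisson_weight_le_half[OF S(1) tpos r S(3), of k] by simp
    qed
    moreover have "1 / 2 \<le> ln (2 :: real)" using one_minus_le_ln[of 2] by simp
    then have "real (card S) * (1 / 2) \<le> real (card S) * ln 2" by (intro mult_left_mono) auto
    ultimately show ?thesis by (simp add: l_def algebra_simps)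
  qed
  have "real (dimension (profile xs)) \<le> 400000 * l\<^sup>2 * (1 + H)"
    if "\<forall>x\<in>set xs. \<bar>sqrt (real (count_list xs x)) - sqrt (real n * pmf p x)\<bar> \<le> R" for xs
  proof -
    have "real (dimension (profile xs)) \<le> (real j0 + R)\<^sup>2 + 9000 * R * real (card S)"
      using dimension_le_sum_bands[OF R3(1) j0(1,2), of xs n p] that by (simp add: S(4))
    \<comment> \<open>\<open>j0 + R \<le> 2 * R + 501 = 503 + 4 * l\<close>, and
      \<open>l \<ge> 1\<close>.\<close>
    also have "(real j0 + R)\<^sup>2 \<le> (507 * l)\<^sup>2"
      using j0 R3 l by (intro power_mono) (auto simp: R)
    also have "9000 * R * real (card S) \<le> 9000 * (3 * l) * (4 * H + 2 * l)"
      using card R3 l by (intro mult_mono) auto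
    also have "(507 * l)\<^sup>2 + 9000 * (3 * l) * (4 * H + 2 * l) = 311049 * l\<^sup>2 + 108000 * (l * H)"
      by (simp add: power2_eq_square algebra_simps)
    also have "\<dots> \<le> 311049 * l\<^sup>2 + 108000 * (l * (l * H))"
      using l H mult_right_mono[of 1 l H] by (intro add_left_mono mult_left_mono) auto
    also have "\<dots> \<le> 400000 * l\<^sup>2 * (1 + H)"
      using l H zero_le_mult_iff[of "l * l" H] by (simp add: power2_eq_square algebra_simps)
    finally show ?thesis by simp
  qed
  then have "measure_pmf.prob (replicate_pmf n p)
     {xs. \<forall>x\<in>set xs. \<bar>sqrt (real (count_list xs x)) - sqrt (real n * pmf p x)\<bar> \<le> R}
     \<le> measure_pmf.prob (replicate_pmf n p) {xs. real (dimension (profile xs)) \<le> 400000 * l\<^sup>2 * (1 + H)}"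
    by (intro measure_pmf.finite_measure_mono) auto
  then show ?thesis
    using prob_counts_concentrated[OF n R_def, of p] unfolding l_def H_def by linarith
qed

section \<open>Competitive estimation of entropy\<close>

text \<open>Naturalness constrains each sample separately; isolating one sample allows an estimator
  to be altered there alone.\<close>

definition natural_pmf :: "'a set \<Rightarrow> 'a list \<Rightarrow> 'a pmf \<Rightarrow> bool" where
  "natural_pmf X xs q \<longleftrightarrow> set_pmf q \<subseteq> X \<and>
     (\<forall>x\<in>X. \<forall>y\<in>X. count_list xs x = count_list xs y \<longrightarrow> pmf q x = pmf q y)"

lemma natural_estimators_iff:
  "q \<in> natural_estimators X n \<longleftrightarrow> (\<forall>xs\<in>samples X n. natural_pmf X xs (q xs))"
  by (simp add: natural_estimators_def natural_pmf_def)

definition same_count :: "'a set \<Rightarrow> 'a list \<Rightarrow> 'a \<Rightarrow> 'a set" where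
  "same_count X xs x = {y \<in> X. count_list xs y = count_list xs x}"

(* The minimizer of the KL loss among natural distributions: it spreads the mass that p gives to
   a class of symbols of equal multiplicity uniformly over that class. *)
definition class_average :: "'a set \<Rightarrow> 'a list \<Rightarrow> 'a pmf \<Rightarrow> 'a pmf" where
  "class_average X xs p = bind_pmf p (\<lambda>x. pmf_of_set (same_count X xs x))"

text \<open>A natural \<open>e\<close> is constant on the class and positive at \<open>x\<close>,
  and only finitely many symbols can share a positive probability. This excludes an infinite class
  of unseen symbols.\<close>

lemma finite_same_count:
  assumes "natural_pmf X xs e" "set_pmf p \<subseteq> set_pmf e" "x \<in> set_pmf p"
  shows "finite (same_count X xs x)"
proof (rule finite_subset)
  have "x \<in> set_pmf e" using assms by blast
  then have x: "x \<in> X" "pmf e x > 0"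
    using assms(1) unfolding natural_pmf_def by (blast, simp add: pmf_pos set_pmf_iff)
  then show "finite {y. pmf e x \<le> pmf e y}" by (intro finite_pmf_ge)
  show "same_count X xs x \<subseteq> {y. pmf e x \<le> pmf e y}"
  proof
    fix y assume "y \<in> same_count X xs x"
    then have "y \<in> X" "count_list xs x = count_list xs y" by (simp_all add: same_count_def)
    then have "pmf e x = pmf e y" using assms(1) x(1) unfolding natural_pmf_def by blast
    then show "y \<in> {y. pmf e x \<le> pmf e y}" by simp
  qed
qed

text \<open>Finiteness of the classes ensures that \<open>pmf_of_set\<close> in
  \<open>class_average\<close> is the uniform law.\<close>

context
  fixes X :: "'a set" and xs :: "'a list" and p :: "'a pmf"
  assumes finp: "finite (set_pmf p)" and pX: "set_pmf p \<subseteq> X"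
    and finite_classes: "\<forall>x\<in>set_pmf p. finite (same_count X xs x)"
begin

lemma mem_same_count: "x \<in> set_pmf p \<Longrightarrow> x \<in> same_count X xs x"
  using pX by (auto simp: same_count_def)

lemma pmf_class_average:
  "pmf (class_average X xs p) y
     = (\<Sum>x\<in>set_pmf p. indicator (same_count X xs x) y / real (card (same_count X xs x)) * pmf p x)"
proof -
  have "pmf (pmf_of_set (same_count X xs x)) y
      = indicator (same_count X xs x) y / real (card (same_count X xs x))" if "x \<in> set_pmf p" for x
    using bspec[OF finite_classes that] mem_same_count[OF that] by (subst pmf_of_set) auto
  then show ?thesis
    unfolding class_average_def pmf_bind
    by (subst integral_measure_pmf_real[OF finp]) (auto intro!: sum.cong)
qed

lemma set_class_average: "set_pmf (class_average X xs p) = (\<Union>x\<in>set_pmf p. same_count X xs x)"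
proof -
  have "set_pmf (pmf_of_set (same_count X xs x)) = same_count X xs x" if "x \<in> set_pmf p" for x
    using bspec[OF finite_classes that] mem_same_count[OF that] by (intro set_pmf_of_set) auto
  then show ?thesis by (simp add: class_average_def)
qed

lemma finite_set_class_average: "finite (set_pmf (class_average X xs p))"
  unfolding set_class_average by (rule finite_UN_I[OF finp bspec[OF finite_classes]])

lemma natural_class_average: "natural_pmf X xs (class_average X xs p)"
  unfolding natural_pmf_def
proof (intro conjI ballI impI)
  show "set_pmf (class_average X xs p) \<subseteq> X" by (auto simp: set_class_average same_count_def)
  fix x y assume "x \<in> X" "y \<in> X" "count_list xs x = count_list xs y"
  then have "indicator (same_count X xs z) x = (indicator (same_count X xs z) y :: real)" for z
    by (simp add: same_count_def indicator_def)
  then show "pmf (class_average X xs p) x = pmf (class_average X xs p) y"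
    by (simp add: pmf_class_average)
qed

text \<open>Averaging moves mass only within classes, so it preserves the expectation of functions
  constant on them.\<close>

lemma sum_class_average:
  assumes g: "\<And>x y. x \<in> set_pmf p \<Longrightarrow> y \<in> same_count X xs x \<Longrightarrow> g y = g x"
  shows "(\<Sum>y\<in>set_pmf (class_average X xs p). pmf (class_average X xs p) y * g y) = (\<Sum>x\<in>set_pmf p. pmf p x * g x)"
proof -
  let ?A = "set_pmf (class_average X xs p)"
  let ?c = "same_count X xs"
  have "(\<Sum>y\<in>?A. pmf (class_average X xs p) y * g y)
      = (\<Sum>x\<in>set_pmf p. \<Sum>y\<in>?A. indicator (?c x) y / real (card (?c x)) * pmf p x * g y)"
    by (simp add: pmf_class_average sum_distrib_right) (rule sum.swap)
  also have "\<dots> = (\<Sum>x\<in>set_pmf p. pmf p x * g x)"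
  proof (rule sum.cong[OF refl])
    fix x assume x: "x \<in> set_pmf p"
    have "(\<Sum>y\<in>?A. indicator (?c x) y / real (card (?c x)) * pmf p x * g y)
        = (\<Sum>y\<in>?c x. indicator (?c x) y / real (card (?c x)) * pmf p x * g y)"
      using x finite_set_class_average by (intro sum.mono_neutral_right) (auto simp: set_class_average)
    also have "\<dots> = (\<Sum>y\<in>?c x. pmf p x * g x / real (card (?c x)))"
      using g x by (intro sum.cong) auto
    also have "\<dots> = pmf p x * g x"
      using bspec[OF finite_classes x] mem_same_count[OF x] by (auto simp: card_eq_0_iff)
    finally show "(\<Sum>y\<in>?A. indicator (?c x) y / real (card (?c x)) * pmf p x * g y) = pmf p x * g x" .
  qed
  finally show ?thesis .
qed

lemma set_class_average_subset:
  assumes "natural_pmf X xs e" "set_pmf p \<subseteq> set_pmf e"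
  shows "set_pmf (class_average X xs p) \<subseteq> set_pmf e"
proof
  fix y assume "y \<in> set_pmf (class_average X xs p)"
  then obtain x where x: "x \<in> set_pmf p" "y \<in> same_count X xs x" by (auto simp: set_class_average)
  then have "x \<in> X" "y \<in> X" "count_list xs y = count_list xs x" using pX by (auto simp: same_count_def)
  then have "pmf e y = pmf e x" using assms(1) unfolding natural_pmf_def by blast
  then show "y \<in> set_pmf e" using assms(2) x(1) by (auto simp: set_pmf_iff)
qed

text \<open>The logarithm of \<open>pmf A / pmf e\<close> is constant on classes, so
  \<open>p\<close> and \<open>A\<close> give it the same expectation. Only the second term on the
  right depends on \<open>e\<close>, which makes \<open>A\<close> the minimizer.\<close>

lemma kl_pythagoras:
  assumes e: "natural_pmf X xs e" "set_pmf p \<subseteq> set_pmf e"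
  defines "A \<equiv> class_average X xs p"
  shows "(\<Sum>x\<in>set_pmf p. pmf p x * ln (pmf p x / pmf e x))
    = (\<Sum>x\<in>set_pmf p. pmf p x * ln (pmf p x / pmf A x)) + (\<Sum>y\<in>set_pmf A. pmf A y * ln (pmf A y / pmf e y))"
proof -
  have "(\<Sum>y\<in>set_pmf A. pmf A y * ln (pmf A y / pmf e y)) = (\<Sum>x\<in>set_pmf p. pmf p x * ln (pmf A x / pmf e x))"
    unfolding A_def
  proof (rule sum_class_average)
    fix x y assume "x \<in> set_pmf p" "y \<in> same_count X xs x"
    then have "x \<in> X" "y \<in> X" "count_list xs y = count_list xs x" using pX by (auto simp: same_count_def)
    then show "ln (pmf (class_average X xs p) y / pmf e y) = ln (pmf (class_average X xs p) x / pmf e x)"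
      using natural_class_average e(1) unfolding natural_pmf_def by metis
  qed
  moreover have "pmf p x * ln (pmf p x / pmf e x) = pmf p x * ln (pmf p x / pmf A x) + pmf p x * ln (pmf A x / pmf e x)"
    if x: "x \<in> set_pmf p" for x
  proof -
    have "x \<in> set_pmf A" using x mem_same_count by (auto simp: A_def set_class_average)
    then have "pmf p x > 0" "pmf A x > 0" "pmf e x > 0" using x e(2) by (auto simp: pmf_pos set_pmf_iff)
    then show ?thesis by (simp add: ln_div algebra_simps)
  qed
  ultimately show ?thesis by (simp add: sum.distrib)
qed

end

section \<open>From divergence to entropy difference\<close>

lemma kl_loss_finite_support:
  assumes "finite (set_pmf p)" "set_pmf p \<subseteq> set_pmf q"
  shows "kl_loss p q = ereal (\<Sum>x\<in>set_pmf p. pmf p x * ln (pmf p x / pmf q x))"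
  using assms by (simp add: kl_loss_def)

text \<open>Pinsker up to a constant, through the Hellinger distance: with \<open>a\<close>,
  \<open>b\<close> the square roots of the probabilities,
  \<open>K \<ge> 2 - 2 * (\<Sum>x\<in>F. a x * b x)\<close> dominates the sum of
  \<open>(a x - b x)^2\<close>. Then factor the differences of squares and apply Cauchy-Schwarz.
  \<open>F\<close> need not carry all mass of \<open>B\<close>, which suffices since that mass
  enters only through an upper bound.\<close>

lemma sum_abs_diff_le_sqrt_kl:
  assumes F: "finite F" "set_pmf A \<subseteq> F" and AB: "set_pmf A \<subseteq> set_pmf B"
  defines "K \<equiv> (\<Sum>x\<in>set_pmf A. pmf A x * ln (pmf A x / pmf B x))"
  shows "0 \<le> K" "(\<Sum>x\<in>F. \<bar>pmf A x - pmf B x\<bar>) \<le> 2 * sqrt K"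
proof -
  define a b where "a x = sqrt (pmf A x)" and "b x = sqrt (pmf B x)" for x
  have sq: "(a x)\<^sup>2 = pmf A x" "(b x)\<^sup>2 = pmf B x" "a x \<ge> 0" "b x \<ge> 0" for x
    by (auto simp: a_def b_def)
  have finA: "finite (set_pmf A)" using F finite_subset by blast
  have sA: "(\<Sum>x\<in>F. (a x)\<^sup>2) = 1" "(\<Sum>x\<in>set_pmf A. (a x)\<^sup>2) = 1"
    unfolding sq using F finA by (auto intro!: sum_pmf_eq_1)
  have sB: "(\<Sum>x\<in>F. (b x)\<^sup>2) \<le> 1"
    unfolding sq using F(1) by (simp flip: measure_measure_pmf_finite)
  have "(\<Sum>x\<in>set_pmf A. 2 * (a x)\<^sup>2 - 2 * (a x * b x)) \<le> K"
    unfolding K_def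
  proof (rule sum_mono)
    fix x assume x: "x \<in> set_pmf A"
    have pos: "a x > 0" "b x > 0" using x AB by (auto simp: a_def b_def pmf_pos set_pmf_iff)
    have "1 - 1 / (a x / b x) \<le> ln (a x / b x)" using pos by (intro one_minus_le_ln) auto
    then have "2 * (a x)\<^sup>2 * (1 - b x / a x) \<le> 2 * (a x)\<^sup>2 * ln (a x / b x)"
      using pos by (intro mult_left_mono) auto
    also have "\<dots> = pmf A x * ln ((a x)\<^sup>2 / (b x)\<^sup>2)"
      using pos by (simp add: ln_div ln_realpow right_diff_distrib flip: sq(1))
    finally show "2 * (a x)\<^sup>2 - 2 * (a x * b x) \<le> pmf A x * ln (pmf A x / pmf B x)"
      using pos by (simp add: sq(1,2) algebra_simps power2_eq_square[of "a x"] flip: sq(1))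
  qed
  then have "2 - 2 * (\<Sum>x\<in>set_pmf A. a x * b x) \<le> K"
    by (simp add: sum_subtractf sum_distrib_left[symmetric] sA)
  also have "(\<Sum>x\<in>set_pmf A. a x * b x) = (\<Sum>x\<in>F. a x * b x)"
    using F by (intro sum.mono_neutral_left) (auto simp: a_def set_pmf_iff)
  finally have K: "2 - 2 * (\<Sum>x\<in>F. a x * b x) \<le> K" .
  have "(\<Sum>x\<in>F. (a x - b x)\<^sup>2) = (\<Sum>x\<in>F. (a x)\<^sup>2) + (\<Sum>x\<in>F. (b x)\<^sup>2) - 2 * (\<Sum>x\<in>F. a x * b x)"
    by (simp add: power2_diff sum.distrib sum_subtractf sum_distrib_left mult.assoc)
  then have d: "(\<Sum>x\<in>F. (a x - b x)\<^sup>2) \<le> K" using K sA sB by linarith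
  show K0: "0 \<le> K" using d sum_nonneg[of F "\<lambda>x. (a x - b x)\<^sup>2"] by simp
  have "(\<Sum>x\<in>F. (a x + b x)\<^sup>2) \<le> (\<Sum>x\<in>F. 2 * (a x)\<^sup>2 + 2 * (b x)\<^sup>2)"
  proof (rule sum_mono)
    show "(a x + b x)\<^sup>2 \<le> 2 * (a x)\<^sup>2 + 2 * (b x)\<^sup>2" for x
      using zero_le_power2[of "a x - b x"] by (simp add: power2_diff power2_sum)
  qed
  also have "\<dots> \<le> 4" using sA sB by (simp add: sum.distrib sum_distrib_left[symmetric])
  finally have s: "(\<Sum>x\<in>F. (a x + b x)\<^sup>2) \<le> 4" .
  have abs: "\<bar>pmf A x - pmf B x\<bar> = \<bar>a x - b x\<bar> * (a x + b x)" for x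
  proof -
    have "\<bar>a x - b x\<bar> * (a x + b x) = \<bar>(a x - b x) * (a x + b x)\<bar>" using sq(3,4)[of x] by (simp add: abs_mult)
    also have "(a x - b x) * (a x + b x) = (a x)\<^sup>2 - (b x)\<^sup>2" by (simp add: power2_eq_square algebra_simps)
    finally show ?thesis by (simp add: sq)
  qed
  have "(\<Sum>x\<in>F. \<bar>pmf A x - pmf B x\<bar>)\<^sup>2 \<le> (\<Sum>x\<in>F. \<bar>a x - b x\<bar>\<^sup>2) * (\<Sum>x\<in>F. (a x + b x)\<^sup>2)"
    unfolding abs by (rule Cauchy_Schwarz_ineq_sum)
  also have "\<dots> \<le> K * 4"
    using d s K0 by (intro mult_mono) (auto intro!: sum_nonneg)
  finally have "(\<Sum>x\<in>F. \<bar>pmf A x - pmf B x\<bar>) \<le> sqrt (K * 4)" by (rule real_le_rsqrt)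
  then show "(\<Sum>x\<in>F. \<bar>pmf A x - pmf B x\<bar>) \<le> 2 * sqrt K" by (simp add: real_sqrt_mult)
qed

text \<open>With \<open>L = ln (1 / q)\<close>, the difference of entropies is the sum of
  \<open>(A - q) * L\<close> minus \<open>K\<close>. The lower bound on \<open>q\<close> gives
  \<open>0 \<le> L \<le> 4 * ln n\<close>, so the sum is controlled by the total variation. It also
  gives \<open>K \<le> 4 * ln n\<close>, so \<open>K\<close> is at most a logarithmic multiple of
  \<open>sqrt K\<close>.\<close>

lemma entropy_diff_le_sqrt_kl:
  assumes n: "n \<ge> 1" and F: "finite (set_pmf q)" and Aq: "set_pmf A \<subseteq> set_pmf q"
    and min: "\<And>x. x \<in> set_pmf q \<Longrightarrow> 1 / real n ^ 4 \<le> pmf q x"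
  defines "K \<equiv> (\<Sum>x\<in>set_pmf A. pmf A x * ln (pmf A x / pmf q x))"
  shows "\<bar>(\<Sum>x\<in>set_pmf q. pmf A x * ln (1 / pmf A x)) - (\<Sum>x\<in>set_pmf q. pmf q x * ln (1 / pmf q x))\<bar>
     \<le> 10 * (1 + ln (real n)) * sqrt K"
proof -
  let ?F = "set_pmf q"
  define L where "L x = ln (1 / pmf q x)" for x
  have nr: "real n \<ge> 1" using n by simp
  have lnn: "ln (real n) \<ge> 0" using nr by simp
  have K0: "0 \<le> K" and tv: "(\<Sum>x\<in>?F. \<bar>pmf A x - pmf q x\<bar>) \<le> 2 * sqrt K"
    using sum_abs_diff_le_sqrt_kl[OF F Aq Aq] by (simp_all add: K_def)
  have L: "0 \<le> L x" "L x \<le> 4 * ln (real n)" if x: "x \<in> ?F" for x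
  proof -
    have q: "pmf q x > 0" using x by (simp add: pmf_pos set_pmf_iff)
    then show "0 \<le> L x" unfolding L_def by (intro ln_ge_zero) (simp add: pmf_le_1)
    have "1 / pmf q x \<le> real n ^ 4" using min[OF x] q nr by (simp add: field_simps)
    then have "L x \<le> ln (real n ^ 4)" unfolding L_def using q by (intro ln_mono) auto
    then show "L x \<le> 4 * ln (real n)" using nr by (simp add: ln_realpow)
  qed
  have "K = (\<Sum>x\<in>?F. pmf A x * ln (pmf A x / pmf q x))"
    unfolding K_def using F Aq by (intro sum.mono_neutral_left) (auto simp: set_pmf_iff)
  also have "\<dots> = (\<Sum>x\<in>?F. pmf A x * L x - pmf A x * ln (1 / pmf A x))"
  proof (rule sum.cong[OF refl])
    fix x assume x: "x \<in> ?F"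
    then have q: "pmf q x > 0" by (simp add: pmf_pos set_pmf_iff)
    show "pmf A x * ln (pmf A x / pmf q x) = pmf A x * L x - pmf A x * ln (1 / pmf A x)"
    proof (cases "pmf A x = 0")
      case False
      then have "pmf A x > 0" by (simp add: pmf_pos)
      then show ?thesis using q by (simp add: L_def ln_div algebra_simps)
    qed simp
  qed
  finally have K: "K = (\<Sum>x\<in>?F. pmf A x * L x) - (\<Sum>x\<in>?F. pmf A x * ln (1 / pmf A x))"
    by (simp add: sum_subtractf)
  have "(\<Sum>x\<in>?F. pmf A x * L x) \<le> (\<Sum>x\<in>?F. pmf A x * (4 * ln (real n)))"
    using L by (intro sum_mono mult_left_mono) auto
  also have "\<dots> = 4 * ln (real n)"
    using sum_pmf_eq_1[OF F Aq] by (simp flip: sum_distrib_right)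
  finally have "K \<le> 4 * ln (real n)"
    using K sum_nonneg[of ?F "\<lambda>x. pmf A x * ln (1 / pmf A x)"] pmf_entropy_summand_nonneg[of A] by simp
  also have "\<dots> \<le> (2 * (1 + ln (real n)))\<^sup>2"
    using lnn by (simp add: power2_eq_square algebra_simps)
  finally have "sqrt K \<le> 2 * (1 + ln (real n))"
    using lnn by (intro real_le_lsqrt) auto
  then have "sqrt K * sqrt K \<le> 2 * (1 + ln (real n)) * sqrt K"
    using K0 by (intro mult_right_mono) auto
  then have K2: "K \<le> 2 * (1 + ln (real n)) * sqrt K" using K0 by simp
  have "\<bar>\<Sum>x\<in>?F. (pmf A x - pmf q x) * L x\<bar> \<le> (\<Sum>x\<in>?F. \<bar>pmf A x - pmf q x\<bar> * (4 * ln (real n)))"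
    using L by (intro order_trans[OF sum_abs] sum_mono) (auto simp: abs_mult intro!: mult_left_mono)
  also have "\<dots> = (\<Sum>x\<in>?F. \<bar>pmf A x - pmf q x\<bar>) * (4 * ln (real n))"
    by (simp add: sum_distrib_right)
  also have "\<dots> \<le> 2 * sqrt K * (4 * ln (real n))"
    using tv lnn by (intro mult_right_mono) auto
  also have "\<dots> \<le> 8 * (1 + ln (real n)) * sqrt K"
    using K0 by (simp add: algebra_simps)
  finally have "\<bar>\<Sum>x\<in>?F. (pmf A x - pmf q x) * L x\<bar> \<le> 8 * (1 + ln (real n)) * sqrt K" .
  moreover have "(\<Sum>x\<in>?F. (pmf A x - pmf q x) * L x) = (\<Sum>x\<in>?F. pmf A x * L x) - (\<Sum>x\<in>?F. pmf q x * L x)"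
    by (simp add: left_diff_distrib sum_subtractf)
  moreover have "8 * (1 + ln (real n)) * sqrt K + 2 * (1 + ln (real n)) * sqrt K = 10 * (1 + ln (real n)) * sqrt K"
    by (simp add: algebra_simps)
  ultimately show ?thesis using K K2 K0 unfolding L_def[symmetric] by linarith
qed

lemma entropy_loss_diff_le:
  fixes p :: "'a pmf"
  assumes n: "n \<ge> 1" and pX: "set_pmf p \<subseteq> X" and xs: "xs \<in> samples X n"
    and ps: "ps \<in> natural_estimators X n"
    and min: "\<And>x. x \<in> set_pmf (ps xs) \<Longrightarrow> 1 / real n ^ 4 \<le> pmf (ps xs) x"
    and best: "best_natural_estimator X n p pN" and fin: "kl_loss p (pN xs) < \<infinity>"
    and excess: "kl_loss p (ps xs) - best_natural_kl X n p xs \<le> ereal \<delta>"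
  shows "entropy_loss p (ps xs) - entropy_loss p (pN xs) \<le> ereal (10 * (1 + ln (real n)) * sqrt \<delta>)"
proof -
  let ?q = "ps xs"
  have opt: "kl_loss p (pN xs) \<le> kl_loss p (e xs)" if "e \<in> natural_estimators X n" for e
    using best xs that unfolding best_natural_estimator_def is_arg_min_def by (auto simp: not_less)
  have pN: "pN \<in> natural_estimators X n"
    using best xs unfolding best_natural_estimator_def is_arg_min_def by blast
  have nat_q: "natural_pmf X xs ?q" and nat_N: "natural_pmf X xs (pN xs)"
    using ps pN xs by (auto simp: natural_estimators_iff)
  have "best_natural_kl X n p xs = kl_loss p (pN xs)"
    unfolding best_natural_kl_def using pN opt by (intro antisym INF_lower INF_greatest) auto
  moreover obtain r where r: "kl_loss p (pN xs) = ereal r" and pN_sub: "set_pmf p \<subseteq> set_pmf (pN xs)"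
    using fin by (auto simp: kl_loss_def split: if_splits)
  ultimately have ex: "kl_loss p ?q - ereal r \<le> ereal \<delta>" using excess by simp
  \<comment> \<open>A finite excess forces a finite loss. Since \<open>?q\<close> has finite support
    by its lower bound, \<open>p\<close> then has finite support too, even over an infinite
    alphabet.\<close>
  then have q_sub: "set_pmf p \<subseteq> set_pmf ?q" by (auto simp: kl_loss_def split: if_splits)
  have "set_pmf ?q \<subseteq> {x. 1 / real n ^ 4 \<le> pmf ?q x}" using min by blast
  then have finq: "finite (set_pmf ?q)" using n by (intro finite_subset[OF _ finite_pmf_ge]) auto
  have finp: "finite (set_pmf p)" using finq q_sub finite_subset by blast
  have "\<forall>x\<in>set_pmf p. finite (same_count X xs x)"
    using finite_same_count[OF nat_q q_sub] by blast
  note ctxt = finp pX this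
  define A where "A = class_average X xs p"
  have A_nat: "natural_pmf X xs A" unfolding A_def by (rule natural_class_average[OF ctxt])
  have finA: "finite (set_pmf A)" unfolding A_def by (rule finite_set_class_average[OF ctxt])
  have p_A: "set_pmf p \<subseteq> set_pmf A"
    unfolding A_def set_class_average[OF ctxt] using mem_same_count[OF ctxt] by blast
  have A_q: "set_pmf A \<subseteq> set_pmf ?q" unfolding A_def by (rule set_class_average_subset[OF ctxt nat_q q_sub])
  have A_N: "set_pmf A \<subseteq> set_pmf (pN xs)" unfolding A_def by (rule set_class_average_subset[OF ctxt nat_N pN_sub])
  define KL where "KL e = (\<Sum>y\<in>set_pmf A. pmf A y * ln (pmf A y / pmf e y))" for e
  define s where "s = (\<Sum>x\<in>set_pmf p. pmf p x * ln (pmf p x / pmf A x))"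
  have "kl_loss p (pN xs) = ereal (s + KL (pN xs))"
    unfolding kl_loss_finite_support[OF finp pN_sub] kl_pythagoras[OF ctxt nat_N pN_sub] s_def KL_def A_def ..
  then have rs: "r = s + KL (pN xs)" using r by simp
  \<comment> \<open>Competing with \<open>A\<close> at this one sample shows that the minimizer has
    divergence 0 from \<open>A\<close>, hence equals \<open>A\<close>.\<close>
  have "pN(xs := A) \<in> natural_estimators X n"
    using pN A_nat by (simp add: natural_estimators_iff)
  from opt[OF this] have "s + KL (pN xs) \<le> s"
    using r rs kl_loss_finite_support[OF finp p_A] by (simp add: s_def)
  then have KLN: "KL (pN xs) \<le> 0" by simp
  have eq: "pN xs = A"
  proof (rule pmf_eqI)
    fix y
    \<comment> \<open>Adjoining \<open>y\<close> makes the comparison cover points outside the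
      support of \<open>A\<close>.\<close>
    let ?F = "insert y (set_pmf A)"
    have "0 \<le> KL (pN xs)" "(\<Sum>x\<in>?F. \<bar>pmf A x - pmf (pN xs) x\<bar>) \<le> 2 * sqrt (KL (pN xs))"
      using sum_abs_diff_le_sqrt_kl[of ?F A "pN xs"] finA A_N unfolding KL_def by auto
    then have "(\<Sum>x\<in>?F. \<bar>pmf A x - pmf (pN xs) x\<bar>) \<le> 0" using KLN by simp
    moreover have "\<bar>pmf A y - pmf (pN xs) y\<bar> \<le> (\<Sum>x\<in>?F. \<bar>pmf A x - pmf (pN xs) x\<bar>)"
      using finA by (intro member_le_sum) auto
    ultimately show "pmf (pN xs) y = pmf A y" by simp
  qed
  have "KL (pN xs) = 0" unfolding eq KL_def by (intro sum.neutral) (auto simp: set_pmf_iff)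
  then have "r = s" using rs by simp
  moreover have "kl_loss p ?q = ereal (s + KL ?q)"
    unfolding kl_loss_finite_support[OF finp q_sub] kl_pythagoras[OF ctxt nat_q q_sub] s_def KL_def A_def ..
  ultimately have KLq: "KL ?q \<le> \<delta>" using ex by simp
  define HA where "HA = (\<Sum>x\<in>set_pmf ?q. pmf A x * ln (1 / pmf A x))"
  define Hq where "Hq = (\<Sum>x\<in>set_pmf ?q. pmf ?q x * ln (1 / pmf ?q x))"
  define Hp where "Hp = (\<Sum>x\<in>set_pmf p. pmf p x * ln (1 / pmf p x))"
  have H: "shannon_entropy p = ereal Hp" "shannon_entropy A = ereal HA" "shannon_entropy ?q = ereal Hq"
    unfolding Hp_def HA_def Hq_def using finp finq A_q by (auto intro!: shannon_entropy_finite)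
  have "\<bar>HA - Hq\<bar> \<le> 10 * (1 + ln (real n)) * sqrt (KL ?q)"
    unfolding HA_def Hq_def KL_def by (rule entropy_diff_le_sqrt_kl[OF n finq A_q min])
  also have "\<dots> \<le> 10 * (1 + ln (real n)) * sqrt \<delta>"
    using KLq n by (intro mult_left_mono) (auto intro!: add_nonneg_nonneg)
  finally have "\<bar>Hp - Hq\<bar> - \<bar>Hp - HA\<bar> \<le> 10 * (1 + ln (real n)) * sqrt \<delta>" by linarith
  then show ?thesis unfolding entropy_loss_def eq H by simp
qed

theorem theorem4:
  fixes c :: real
  assumes "c > 0"
  shows "\<exists>C>0. \<forall>(X :: 'a set) (n :: nat) (p :: 'a pmf) pstar pN.
           countable X \<longrightarrow> n \<ge> 1 \<longrightarrow> set_pmf p \<subseteq> X \<longrightarrow>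
           competitive_estimator c X n pstar \<longrightarrow>
           best_natural_estimator X n p pN \<longrightarrow>
           measure_pmf.prob (replicate_pmf n p)
             {xs. kl_loss p (pN xs) < \<infinity> \<longrightarrow>
                  entropy_loss p (pstar xs) - entropy_loss p (pN xs)
                    \<le> ereal (C * (1 + ln (real n)) powr C *
                         sqrt (real_of_int (strict_ceiling (profile_entropy n p)) / real n))}
           \<ge> 1 - C / real n"
proof -
  \<comment> \<open>Three demands on one constant: \<open>1 + c\<close> for the two failure
    probabilities, \<open>2 + c / 2\<close> for the exponent of \<open>l\<close>, and
    \<open>10 * sqrt (800000 * c)\<close> for the factor, where \<open>800000\<close> is
    \<open>400000\<close> times the 2 in \<open>1 + H \<le> 2 * h\<close>.\<close>
  define C where "C = 3 + c + 10 * sqrt (800000 * c)"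
  have C: "C > 0" "C \<ge> 1 + c" "C \<ge> 2 + c / 2" "C \<ge> 10 * sqrt (800000 * c)"
    using assms by (auto simp: C_def intro!: add_pos_nonneg)
  show ?thesis
  proof (intro exI[of _ C] conjI C(1) allI impI)
    fix X :: "'a set" and n :: nat and p :: "'a pmf" and pstar pN
    assume n: "n \<ge> 1" and pX: "set_pmf p \<subseteq> X" and comp: "competitive_estimator c X n pstar"
      and best: "best_natural_estimator X n p pN"
    define l where "l = 1 + ln (real n)"
    define H where "H = profile_entropy n p"
    define h where "h = real_of_int (strict_ceiling H)"
    let ?P = "measure_pmf.prob (replicate_pmf n p)"
    define E1 where "E1 = {xs. best_natural_kl X n p xs < \<infinity> \<longrightarrow>
               kl_loss p (pstar xs) - best_natural_kl X n p xs
                 \<le> ereal (c * l powr c * (real (dimension (profile xs)) / real n))}"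
    define E2 where "E2 = {xs :: 'a list. real (dimension (profile xs)) \<le> 400000 * l\<^sup>2 * (1 + H)}"
    define E where "E = {xs. kl_loss p (pN xs) < \<infinity> \<longrightarrow>
                  entropy_loss p (pstar xs) - entropy_loss p (pN xs) \<le> ereal (C * l powr C * sqrt (h / real n))}"
    have nr: "real n \<ge> 1" using n by simp
    have l: "l \<ge> 1" using nr by (simp add: l_def)
    have "H \<ge> 0" unfolding H_def by (rule profile_entropy_nonneg)
    then have "0 \<le> real_of_int \<lfloor>H\<rfloor>" by simp
    moreover have "H < real_of_int \<lfloor>H\<rfloor> + 1" by simp
    moreover have "h = real_of_int \<lfloor>H\<rfloor> + 1" by (simp add: h_def strict_ceiling_def)
    \<comment> \<open>The strict ceiling is at least 1 and exceeds \<open>H\<close>, so it absorbs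
      the additive 1 even when \<open>H = 0\<close>.\<close>
    ultimately have h: "1 + H \<le> 2 * h" "h \<ge> 0" by linarith+
    have P1: "?P E1 \<ge> 1 - c / real n"
      using comp pX unfolding competitive_estimator_def E1_def l_def by blast
    have P2: "?P E2 \<ge> 1 - 1 / real n"
      unfolding E2_def l_def H_def by (rule prob_dimension_le_entropy[OF n])
    have sub: "(E1 \<inter> E2) \<inter> set_pmf (replicate_pmf n p) \<subseteq> E"
    proof
      fix xs assume a: "xs \<in> (E1 \<inter> E2) \<inter> set_pmf (replicate_pmf n p)"
      then have xs: "xs \<in> samples X n" using pX by (auto simp: samples_def set_replicate_pmf)
      show "xs \<in> E"
        unfolding E_def
      proof (intro CollectI impI)
        assume fin: "kl_loss p (pN xs) < \<infinity>"
        define d where "d = real (dimension (profile xs))"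
        have pN: "pN \<in> natural_estimators X n"
          using best xs unfolding best_natural_estimator_def is_arg_min_def by blast
        have "best_natural_kl X n p xs \<le> kl_loss p (pN xs)"
          unfolding best_natural_kl_def using pN by (intro INF_lower)
        then have "best_natural_kl X n p xs < \<infinity>" using fin by (rule order_le_less_trans)
        then have "kl_loss p (pstar xs) - best_natural_kl X n p xs \<le> ereal (c * l powr c * (d / real n))"
          using a by (simp add: E1_def d_def)
        then have "entropy_loss p (pstar xs) - entropy_loss p (pN xs) \<le> ereal (10 * l * sqrt (c * l powr c * (d / real n)))"
          unfolding l_def
          using comp by (intro entropy_loss_diff_le[OF n pX xs _ _ best fin])
            (use xs in \<open>auto simp: competitive_estimator_def\<close>)
        also have "10 * l * sqrt (c * l powr c * (d / real n)) \<le> C * l powr C * sqrt (h / real n)"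
        proof -
          have "d \<le> 400000 * l\<^sup>2 * (1 + H)" using a by (simp add: E2_def d_def)
          also have "\<dots> \<le> 400000 * l\<^sup>2 * (2 * h)" using h by (intro mult_left_mono) auto
          finally have "c * l powr c * (d / real n) \<le> c * l powr c * (400000 * l\<^sup>2 * (2 * h) / real n)"
            using assms by (intro mult_left_mono divide_right_mono) auto
          also have "\<dots> = (800000 * c) * (l powr (c / 2))\<^sup>2 * l\<^sup>2 * (h / real n)"
            using l by (simp add: power2_eq_square flip: powr_add)
          finally have "sqrt (c * l powr c * (d / real n)) \<le> sqrt ((800000 * c) * (l powr (c / 2))\<^sup>2 * l\<^sup>2 * (h / real n))"
            by (rule real_sqrt_le_mono)
          also have "\<dots> = sqrt (800000 * c) * l powr (c / 2) * l * sqrt (h / real n)"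
            using l by (simp only: real_sqrt_mult real_sqrt_abs) simp
          finally have "10 * l * sqrt (c * l powr c * (d / real n))
             \<le> 10 * l * (sqrt (800000 * c) * l powr (c / 2) * l * sqrt (h / real n))"
            using l by (intro mult_left_mono) auto
          also have "\<dots> = (10 * sqrt (800000 * c)) * l powr (2 + c / 2) * sqrt (h / real n)"
            using l by (simp add: powr_add powr_numeral power2_eq_square)
          also have "\<dots> \<le> C * l powr C * sqrt (h / real n)"
            using C l h by (intro mult_right_mono mult_mono powr_mono) auto
          finally show ?thesis .
        qed
        finally show "entropy_loss p (pstar xs) - entropy_loss p (pN xs) \<le> ereal (C * l powr C * sqrt (h / real n))"
          by simp
      qed
    qed
    have "1 - C / real n \<le> 1 - c / real n - 1 / real n"
      using divide_right_mono[OF C(2), of "real n"] nr by (simp add: add_divide_distrib)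
    also have "\<dots> \<le> 1 - ?P (- E1) - ?P (- E2)"
      using P1 P2 unfolding prob_pmf_Compl by linarith
    also have "\<dots> \<le> 1 - ?P (- E1 \<union> - E2)"
      using measure_Un_le[of "- E1" "measure_pmf (replicate_pmf n p)" "- E2"] by simp
    also have "- E1 \<union> - E2 = - (E1 \<inter> E2)" by blast
    also have "1 - ?P (- (E1 \<inter> E2)) = ?P (E1 \<inter> E2)" unfolding prob_pmf_Compl by simp
    also have "\<dots> = ?P ((E1 \<inter> E2) \<inter> set_pmf (replicate_pmf n p))" by (rule measure_Int_set_pmf[symmetric])
    also have "\<dots> \<le> ?P E" by (intro measure_pmf.finite_measure_mono sub) auto
    finally show "1 - C / real n \<le> ?P {xs. kl_loss p (pN xs) < \<infinity> \<longrightarrow>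
                  entropy_loss p (pstar xs) - entropy_loss p (pN xs)
                    \<le> ereal (C * (1 + ln (real n)) powr C *
                         sqrt (real_of_int (strict_ceiling (profile_entropy n p)) / real n))}"
      unfolding E_def l_def h_def H_def .
  qed
qed

end
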